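(* (i) Every balanced double-chain with $n$ points is $2$-color universal for every equitable caterpillar on $n$ vertices that has at least as many leaves as non-leaf vertices. (ii) If a forest of stars $G$ on $n$ vertices is $2$-colored equitably and properly, then $G$ can be embedded on every balanced double-chain of $n$ points whose points are $2$-colored compatibly with this coloring of $G$. (iii) If an equitable bipartite graph $G$ on $n$ vertices is such that a balanced double-chain with $n$ points is $2$-color universal for $G$, then $G$ is a forest of caterpillars.
   Context: A convex (resp. concave) chain is a finite set of points in the plane lying on the graph of a strictly convex (resp. strictly concave) function. A double-chain $(C_1,C_2)$ consists of a convex chain $C_1$ and a concave chain $C_2$ such that every point of $C_2$ lies strictly below every line determined by two points of $C_1$, and every point of $C_1$ lies strictly above every line determined by two points of $C_2$; it is balanced if $||C_1|-|C_2||\le 1$. Colors are black and white. A $2$-coloring of a point set $S$ with $|S|=|V(G)|$ is compatible with a $2$-coloring of $G$ if $S$ has as many black points as $G$ has black vertices. A $2$-colored graph $G$ is embeddable on a compatibly $2$-colored point set $S$ if there is a color-preserving bijection $V(G)\to S$ such that the straight-line segments representing the edges pairwise do not cross. $S$ is $2$-color universal for a bipartite graph $G$ if for every proper $2$-coloring of $G$ and every compatible $2$-coloring of $S$, $G$ is embeddable on $S$. A $2$-coloring is equitable if the sizes of the two color classes differ by at most $1$; a bipartite graph is equitable if it admits a proper equitable $2$-coloring. A caterpillar is a tree whose non-leaf vertices induce a path. A forest of stars is a graph each of whose components is a star $K_{1,m}$, $m\ge 0$ (including isolated vertices and single edges). *)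

theory Defs
  imports "HOL-Analysis.Analysis" "Graph_Theory.Digraph_Component"
begin

section \<open>Graphs\<close>

text \<open>
  Finite simple undirected graphs are the \<^locale>\<open>graph\<close> instances of \<^type>\<open>pre_digraph\<close>:
  every undirected edge is a pair of opposite arcs. For such a graph \<^const>\<open>out_degree\<close> is
  the degree and \<^const>\<open>pre_digraph.sccs\<close> is the set of connected components.

  The library's notions of forest and tree are not usable here: in a symmetric digraph an edge
  traversed back and forth already counts as a cycle. Undirected cycles are the
  cycles with at least three arcs.
\<close>

definition undirected_tree :: "('a, 'b) pre_digraph \<Rightarrow> bool" where
  "undirected_tree G \<longleftrightarrow>
     graph G \<and> Digraph_Component.connected G \<and>
     \<not> (\<exists>p. pre_digraph.cycle G p \<and> 3 \<le> length p)"

definition leaves :: "('a, 'b) pre_digraph \<Rightarrow> 'a set" where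
  "leaves G = {v \<in> verts G. out_degree G v = 1}"

definition non_leaves :: "('a, 'b) pre_digraph \<Rightarrow> 'a set" where
  "non_leaves G = verts G - leaves G"

text \<open>
  The path graph may be empty or a single vertex, so that a single edge (no non-leaf) and a
  single vertex (one non-leaf) are caterpillars.
\<close>

definition path_graph :: "('a, 'b) pre_digraph \<Rightarrow> bool" where
  "path_graph G \<longleftrightarrow>
     (\<exists>vs. distinct vs \<and> set vs = verts G \<and>
        (\<forall>i < length vs. \<forall>j < length vs. vs ! i \<rightarrow>\<^bsub>G\<^esub> vs ! j \<longleftrightarrow> j = Suc i \<or> i = Suc j))"

definition caterpillar :: "('a, 'b) pre_digraph \<Rightarrow> bool" where
  "caterpillar G \<longleftrightarrow> undirected_tree G \<and> path_graph (G \<restriction> non_leaves G)"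

definition forest_of_caterpillars :: "('a, 'b) pre_digraph \<Rightarrow> bool" where
  "forest_of_caterpillars G \<longleftrightarrow> graph G \<and> (\<forall>H \<in> pre_digraph.sccs G. caterpillar H)"

definition star :: "('a, 'b) pre_digraph \<Rightarrow> bool" where
  "star G \<longleftrightarrow>
     (\<exists>c \<in> verts G. \<forall>u \<in> verts G. \<forall>v \<in> verts G. u \<rightarrow>\<^bsub>G\<^esub> v \<longleftrightarrow> u \<noteq> v \<and> (u = c \<or> v = c))"

definition forest_of_stars :: "('a, 'b) pre_digraph \<Rightarrow> bool" where
  "forest_of_stars G \<longleftrightarrow> graph G \<and> (\<forall>H \<in> pre_digraph.sccs G. star H)"


section \<open>Colorings\<close>

text \<open>A coloring of a set is a total function of which only the values on that set matter.\<close>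

datatype color = Black | White

definition color_class :: "'a set \<Rightarrow> ('a \<Rightarrow> color) \<Rightarrow> color \<Rightarrow> 'a set" where
  "color_class A c k = {x \<in> A. c x = k}"

definition proper_coloring :: "('a, 'b) pre_digraph \<Rightarrow> ('a \<Rightarrow> color) \<Rightarrow> bool" where
  "proper_coloring G c \<longleftrightarrow> (\<forall>u v. u \<rightarrow>\<^bsub>G\<^esub> v \<longrightarrow> c u \<noteq> c v)"

definition equitable_coloring :: "('a, 'b) pre_digraph \<Rightarrow> ('a \<Rightarrow> color) \<Rightarrow> bool" where
  "equitable_coloring G c \<longleftrightarrow>
     \<bar>int (card (color_class (verts G) c Black)) - int (card (color_class (verts G) c White))\<bar> \<le> 1"

definition equitable_graph :: "('a, 'b) pre_digraph \<Rightarrow> bool" where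
  "equitable_graph G \<longleftrightarrow> graph G \<and> (\<exists>c. proper_coloring G c \<and> equitable_coloring G c)"

type_synonym point = "real \<times> real"

definition compatible_coloring ::
  "('a, 'b) pre_digraph \<Rightarrow> ('a \<Rightarrow> color) \<Rightarrow> point set \<Rightarrow> (point \<Rightarrow> color) \<Rightarrow> bool" where
  "compatible_coloring G c S d \<longleftrightarrow>
     finite S \<and> card S = card (verts G) \<and>
     card (color_class S d Black) = card (color_class (verts G) c Black)"


section \<open>Double-chains\<close>

definition strictly_convex :: "(real \<Rightarrow> real) \<Rightarrow> bool" where
  "strictly_convex f \<longleftrightarrow>
     (\<forall>x y t. x \<noteq> y \<longrightarrow> 0 < t \<longrightarrow> t < 1 \<longrightarrow>
        f ((1 - t) * x + t * y) < (1 - t) * f x + t * f y)"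

definition strictly_concave :: "(real \<Rightarrow> real) \<Rightarrow> bool" where
  "strictly_concave f \<longleftrightarrow> strictly_convex (\<lambda>x. - f x)"

definition convex_chain :: "point set \<Rightarrow> bool" where
  "convex_chain C \<longleftrightarrow> finite C \<and> (\<exists>f. strictly_convex f \<and> (\<forall>p \<in> C. snd p = f (fst p)))"

definition concave_chain :: "point set \<Rightarrow> bool" where
  "concave_chain C \<longleftrightarrow> finite C \<and> (\<exists>f. strictly_concave f \<and> (\<forall>p \<in> C. snd p = f (fst p)))"

text \<open>
  Only meaningful for non-vertical lines; two distinct points of a chain always have distinct
  abscissae.
\<close>

definition strictly_below :: "point \<Rightarrow> point set \<Rightarrow> bool" where
  "strictly_below q L \<longleftrightarrow> (\<forall>p \<in> L. fst p = fst q \<longrightarrow> snd q < snd p)"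

definition strictly_above :: "point \<Rightarrow> point set \<Rightarrow> bool" where
  "strictly_above q L \<longleftrightarrow> (\<forall>p \<in> L. fst p = fst q \<longrightarrow> snd p < snd q)"

text \<open>
  Disjointness only matters when both chains are singletons; otherwise it follows from the
  other conditions. It makes a double-chain a set of \<open>card C1 + card C2\<close> points.
\<close>

definition double_chain :: "point set \<Rightarrow> point set \<Rightarrow> bool" where
  "double_chain C1 C2 \<longleftrightarrow>
     convex_chain C1 \<and> concave_chain C2 \<and> C1 \<inter> C2 = {} \<and>
     (\<forall>q \<in> C2. \<forall>a \<in> C1. \<forall>b \<in> C1. a \<noteq> b \<longrightarrow> strictly_below q (affine hull {a, b})) \<and>
     (\<forall>q \<in> C1. \<forall>a \<in> C2. \<forall>b \<in> C2. a \<noteq> b \<longrightarrow> strictly_above q (affine hull {a, b}))"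

definition balanced_double_chain :: "point set \<Rightarrow> point set \<Rightarrow> bool" where
  "balanced_double_chain C1 C2 \<longleftrightarrow>
     double_chain C1 C2 \<and> \<bar>int (card C1) - int (card C2)\<bar> \<le> 1"


section \<open>Embeddings\<close>

text \<open>The segments of two distinct edges may meet only in a common endpoint.\<close>

definition noncrossing :: "('a, 'b) pre_digraph \<Rightarrow> ('a \<Rightarrow> point) \<Rightarrow> bool" where
  "noncrossing G \<phi> \<longleftrightarrow>
     (\<forall>u v x y. u \<rightarrow>\<^bsub>G\<^esub> v \<longrightarrow> x \<rightarrow>\<^bsub>G\<^esub> y \<longrightarrow> {u, v} \<noteq> {x, y} \<longrightarrow>
        closed_segment (\<phi> u) (\<phi> v) \<inter> closed_segment (\<phi> x) (\<phi> y)
          \<subseteq> {\<phi> u, \<phi> v} \<inter> {\<phi> x, \<phi> y})"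

definition embeddable ::
  "('a, 'b) pre_digraph \<Rightarrow> ('a \<Rightarrow> color) \<Rightarrow> point set \<Rightarrow> (point \<Rightarrow> color) \<Rightarrow> bool" where
  "embeddable G c S d \<longleftrightarrow>
     (\<exists>\<phi>. bij_betw \<phi> (verts G) S \<and> (\<forall>v \<in> verts G. d (\<phi> v) = c v) \<and> noncrossing G \<phi>)"

definition two_color_universal :: "point set \<Rightarrow> ('a, 'b) pre_digraph \<Rightarrow> bool" where
  "two_color_universal S G \<longleftrightarrow>
     (\<forall>c d. proper_coloring G c \<longrightarrow> compatible_coloring G c S d \<longrightarrow> embeddable G c S d)"

end

theory Submission
  imports Defs
begin

text \<open>
  The order type of a double-chain decides which segments cross: two segments between the chains
  cross iff they invert the left-to-right order, a segment inside a chain meets none between the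
  chains except at a common end, and two segments inside a chain cross iff their ends interleave.

  If one chain is colored black and the other white, a properly colored graph can only be drawn
  with all its edges between the chains. Such a two-layer drawing excludes cycles and a vertex with
  three non-leaf neighbors, which gives (iii).

  For (i) and (ii), designate one color as the majority color of \<open>C1\<close> and the other one as that of
  \<open>C2\<close>. Some leaves are put aside, just as many as there are points of the minority colors. What
  remains has a two-layer drawing on the majority points; every leaf put aside is then matched to
  a minority point of the chain containing its neighbor, and a closest-pair argument makes this
  matching noncrossing. Enough leaves of both colors exist because at most half of the vertices
  are non-leaves (star centers in (ii)), of which the colors are balanced: along the spine of a
  caterpillar they alternate, and in a forest of stars single edges may choose their center.
\<close>

section \<open>Segments on a double-chain\<close>

text \<open>Whether a designation works depends only on four numbers, the points of each color on
  each chain. With \<open>Z\<close> the set of non-leaves, or of star centers, color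
  \<open>k\<close> on \<open>C1\<close> and \<open>k'\<close> on \<open>C2\<close> are a good choice
  as soon as the color \<open>k\<close> part of \<open>Z\<close> is no larger than the color
  \<open>k\<close> part of \<open>C1\<close>, and likewise for \<open>k'\<close> and
  \<open>C2\<close>; the designated colors need not be actual majorities. Two of the four numbers
  that share a chain or a color add up to at least (n - 1)/2. If both designations failed, the two
  numbers that are too small would form such a pair, against
  \<open>2 * card Z \<le> card (verts G)\<close> and the balance of colors in \<open>Z\<close>.
  Hence the leaf condition in (i). The obstacle in (ii) is that the centers may all have one color:
  copies of a white-black-white path, each with an isolated black vertex, are equitable and have no
  single edge to flip. There the leaves give the bound. If no center of color \<open>k\<close> can
  be flipped, each owns two leaves of the other color, so these centers make up at most about a
  quarter of all vertices.\<close>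

definition orient :: "point \<Rightarrow> point \<Rightarrow> point \<Rightarrow> real" where
  "orient a b c = (fst b - fst a) * (snd c - snd a) - (snd b - snd a) * (fst c - fst a)"

lemma orient_simps [simp]: "orient a b a = 0" "orient a b b = 0"
  by (simp_all add: orient_def algebra_simps)

lemma orient_rotate: "orient b c a = orient a b c"
  by (simp add: orient_def algebra_simps)

text \<open>\<open>orient a b c\<close> is twice the signed area of the triangle and so affine in
  \<open>c\<close>. This reduces all statements about segments to signs at their ends.\<close>

lemma orient_affine:
  "orient a b ((1 - t) *\<^sub>R p + t *\<^sub>R q) = (1 - t) * orient a b p + t * orient a b q"
  by (simp add: orient_def algebra_simps)

text \<open>A convex combination of nonnegative values that is nonpositive has only zero terms. The
  end off the line then has weight 0, so \<open>z\<close> is the other end. The factor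
  \<open>s\<close> selects the side of the line.\<close>

lemma closed_segment_meets_line:
  assumes "z \<in> closed_segment p q" "0 \<le> s * orient a b p" "0 \<le> s * orient a b q"
    and "s * orient a b z \<le> 0" "s * orient a b p \<noteq> 0 \<or> s * orient a b q \<noteq> 0"
  shows "z \<in> {p, q} \<and> s * orient a b z = 0"
proof -
  obtain t where t: "0 \<le> t" "t \<le> 1" "z = (1 - t) *\<^sub>R p + t *\<^sub>R q"
    using assms(1) by (auto simp: in_segment)
  have z: "s * orient a b z = (1 - t) * (s * orient a b p) + t * (s * orient a b q)"
    unfolding t(3) orient_affine by (simp add: algebra_simps)
  have "0 \<le> (1 - t) * (s * orient a b p)" "0 \<le> t * (s * orient a b q)"
    using t assms(2,3) by simp_all
  then have "(1 - t) * (s * orient a b p) = 0" "t * (s * orient a b q) = 0"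
    using z assms(4) by linarith+
  then show ?thesis
    using z assms(5) t(3) by (auto simp: algebra_simps)
qed

lemma closed_segment_misses_line:
  assumes "z \<in> closed_segment p q" "0 < s * orient a b p" "0 < s * orient a b q"
  shows "0 < s * orient a b z"
  using closed_segment_meets_line[OF assms(1), of s a b] assms(2,3) by force

definition meet_at_ends :: "point \<Rightarrow> point \<Rightarrow> point \<Rightarrow> point \<Rightarrow> bool" where
  "meet_at_ends p q p' q' \<longleftrightarrow> closed_segment p q \<inter> closed_segment p' q' \<subseteq> {p, q} \<inter> {p', q'}"

lemma meet_at_ends_swap:
  "meet_at_ends p q p' q' \<longleftrightarrow> meet_at_ends q p p' q'"
  "meet_at_ends p q p' q' \<longleftrightarrow> meet_at_ends p q q' p'"
  by (simp_all only: meet_at_ends_def closed_segment_commute[of p q] closed_segment_commute[of p' q']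
      insert_commute[of p q] insert_commute[of p' q'])

lemma meet_at_ends_commute: "meet_at_ends p q p' q' \<longleftrightarrow> meet_at_ends p' q' p q"
  by (simp add: meet_at_ends_def Int_commute)

text \<open>A common point must lie on the separating line. Neither segment is contained in that
  line, so each reaches it at most in an end.\<close>

lemma meet_at_ends_separated:
  assumes "0 \<le> s * orient a b p" "0 \<le> s * orient a b q"
    and "s * orient a b p' \<le> 0" "s * orient a b q' \<le> 0"
    and "orient a b p \<noteq> 0 \<or> orient a b q \<noteq> 0" "orient a b p' \<noteq> 0 \<or> orient a b q' \<noteq> 0"
    and "s \<noteq> 0"
  shows "meet_at_ends p q p' q'"
proof -
  have "z \<in> {p, q} \<inter> {p', q'}"
    if z: "z \<in> closed_segment p q" "z \<in> closed_segment p' q'" for z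
  proof -
    obtain t where t: "0 \<le> t" "t \<le> 1" "z = (1 - t) *\<^sub>R p' + t *\<^sub>R q'"
      using z(2) by (auto simp: in_segment)
    have "s * orient a b z = (1 - t) * (s * orient a b p') + t * (s * orient a b q')"
      unfolding t(3) orient_affine by (simp add: algebra_simps)
    moreover have "(1 - t) * (s * orient a b p') \<le> 0" "t * (s * orient a b q') \<le> 0"
      using t assms(3,4) by (simp_all add: mult_nonneg_nonpos)
    ultimately have "s * orient a b z \<le> 0"
      by linarith
    then have "z \<in> {p, q} \<and> s * orient a b z = 0"
      using closed_segment_meets_line[OF z(1) assms(1,2)] assms(5,7) by auto
    moreover have "z \<in> {p', q'} \<and> - s * orient a b z = 0"
      using closed_segment_meets_line[OF z(2), of "- s" a b] assms(3,4,6,7) calculation by auto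
    ultimately show ?thesis
      by blast
  qed
  then show ?thesis
    unfolding meet_at_ends_def by blast
qed

text \<open>
  The order type of a double-chain, with \<open>s = 1\<close> for the convex chain \<open>A\<close> and \<open>s = - 1\<close> for the
  concave one; \<open>B\<close> is the opposite chain.
\<close>

definition chain_side :: "real \<Rightarrow> point set \<Rightarrow> point set \<Rightarrow> bool" where
  "chain_side s A B \<longleftrightarrow> s \<noteq> 0 \<and> inj_on fst A \<and>
     (\<forall>a\<in>A. \<forall>a'\<in>A. fst a < fst a' \<longrightarrow>
        (\<forall>a''\<in>A. fst a' < fst a'' \<longrightarrow> 0 < s * orient a a' a'') \<and>
        (\<forall>b\<in>B. s * orient a a' b < 0))"

lemma chain_sideD:
  assumes "chain_side s A B"
  shows "s \<noteq> 0" "inj_on fst A"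
    and "\<lbrakk>a \<in> A; a' \<in> A; a'' \<in> A; fst a < fst a'; fst a' < fst a''\<rbrakk> \<Longrightarrow> 0 < s * orient a a' a''"
    and "\<lbrakk>a \<in> A; a' \<in> A; b \<in> B; fst a < fst a'\<rbrakk> \<Longrightarrow> s * orient a a' b < 0"
  using assms by (auto simp: chain_side_def)

section \<open>Pairs of segments spanned by the points of the two chains\<close>

lemma chain_side_outside:
  assumes "chain_side s A B" "p \<in> A" "q \<in> A" "x \<in> A" "fst p < fst q" "fst x \<notin> {fst p<..<fst q}"
  shows "0 \<le> s * orient p q x \<and> (orient p q x = 0 \<longleftrightarrow> x \<in> {p, q})"
proof (cases "x \<in> {p, q}")
  case False
  then have "fst x \<noteq> fst p" "fst x \<noteq> fst q"
    using assms chain_sideD(2)[OF assms(1)] by (auto dest: inj_onD)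
  with assms(6) consider "fst x < fst p" | "fst q < fst x"
    by fastforce
  then have "0 < s * orient p q x"
  proof cases
    case 1
    then show ?thesis
      using chain_sideD(3)[OF assms(1,4,2,3)] assms(5) by (simp only: orient_rotate)
  next
    case 2
    then show ?thesis
      using chain_sideD(3)[OF assms(1,2,3,4)] assms(5) by blast
  qed
  then show ?thesis
    using False by auto
qed auto

text \<open>If neither \<open>p\<close> nor \<open>q\<close> is strictly between \<open>p'\<close>
  and \<open>q'\<close>, both lie on the same closed side of the line \<open>p' q'\<close>, and
  touch it only in \<open>p'\<close> or \<open>q'\<close>. Nested ends the other way round are
  handled by exchanging the two segments; only interleaving ends escape.\<close>

lemma meet_at_ends_same_chain:
  assumes A: "chain_side s A B" and "p \<in> A" "q \<in> A" "p' \<in> A" "q' \<in> A"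
    and "p \<noteq> q" "p' \<noteq> q'" "{p, q} \<noteq> {p', q'}"
    and "fst p \<notin> open_segment (fst p') (fst q')" "fst q \<notin> open_segment (fst p') (fst q')"
  shows "meet_at_ends p q p' q'"
proof -
  have *: "meet_at_ends p q p' q'"
    if "p' \<in> A" "q' \<in> A" "{p, q} \<noteq> {p', q'}" "fst p' < fst q'"
      "fst p \<notin> {fst p'<..<fst q'}" "fst q \<notin> {fst p'<..<fst q'}" for p' q'
  proof -
    have p: "0 \<le> s * orient p' q' p \<and> (orient p' q' p = 0 \<longleftrightarrow> p \<in> {p', q'})"
      and q: "0 \<le> s * orient p' q' q \<and> (orient p' q' q = 0 \<longleftrightarrow> q \<in> {p', q'})"
      using chain_side_outside[OF A] that assms(2,3) by blast+
    have "orient p' q' p \<noteq> 0 \<or> orient p' q' q \<noteq> 0"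
      using p q that(3) \<open>p \<noteq> q\<close> by auto
    moreover have "orient p' q' z = 0" if "z \<in> closed_segment p' q'" for z
      using that by (auto simp: in_segment orient_affine)
    ultimately have "z \<in> {p, q} \<inter> {p', q'}"
      if "z \<in> closed_segment p q" "z \<in> closed_segment p' q'" for z
      using closed_segment_meets_line[OF that(1), of s p' q'] that p q chain_sideD(1)[OF A]
      by (metis IntI empty_iff insert_iff le_numeral_extra(3) mult_eq_0_iff)
    then show ?thesis
      unfolding meet_at_ends_def by blast
  qed
  have "fst p' \<noteq> fst q'"
    using assms chain_sideD(2)[OF A] by (auto dest: inj_onD)
  then consider "fst p' < fst q'" | "fst q' < fst p'"
    by linarith
  then show ?thesis
  proof cases
    case 1
    then show ?thesis
      using * assms by (simp add: open_segment_eq_real_ivl)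
  next
    case 2
    then have "meet_at_ends p q q' p'"
      using * assms by (simp add: open_segment_eq_real_ivl insert_commute)
    then show ?thesis
      using meet_at_ends_swap(2) by blast
  qed
qed

text \<open>If \<open>a\<close> is strictly between the ends of the chord, the whole bridge lies
  strictly on the side of the chord line facing \<open>B\<close>. If \<open>a\<close> is beyond an
  end, the line through \<open>a\<close> and that end separates chord and bridge. If
  \<open>a\<close> is itself an end, the bridge leaves the chord line there.\<close>

lemma meet_at_ends_chord_bridge:
  assumes A: "chain_side s A B" and "a \<in> A" "b \<in> B" "p \<in> A" "q \<in> A" "p \<noteq> q"
  shows "meet_at_ends p q a b"
proof -
  have *: "meet_at_ends p q a b" if "p \<in> A" "q \<in> A" "fst p < fst q" for p q
  proof -
    have "fst a = fst p \<Longrightarrow> a = p" "fst a = fst q \<Longrightarrow> a = q"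
      using chain_sideD(2)[OF A] that \<open>a \<in> A\<close> by (auto dest: inj_onD)
    then consider "a = p \<or> a = q" | "fst a \<in> {fst p<..<fst q}" | "fst a < fst p" | "fst q < fst a"
      by fastforce
    then show ?thesis
    proof cases
      case 1
      have b: "s * orient p q b < 0"
        using chain_sideD(4)[OF A] that \<open>b \<in> B\<close> by blast
      have "z \<in> {a, b} \<and> - s * orient p q z = 0"
        if "z \<in> closed_segment p q" "z \<in> closed_segment a b" for z
        using closed_segment_meets_line[OF that(2), of "- s" p q] 1 b that(1)
        by (force simp: in_segment orient_affine)
      then show ?thesis
        using 1 b unfolding meet_at_ends_def by fastforce
    next
      case 2
      then have "s * orient p a q > 0"
        using chain_sideD(3)[OF A] that \<open>a \<in> A\<close> by auto
      then have a: "s * orient p q a < 0"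
        by (simp add: orient_def algebra_simps)
      have b: "s * orient p q b < 0"
        using chain_sideD(4)[OF A] that \<open>b \<in> B\<close> by blast
      have "False" if "z \<in> closed_segment p q" "z \<in> closed_segment a b" for z
        using closed_segment_misses_line[OF that(2), of "- s" p q] a b that(1)
        by (auto simp: in_segment orient_affine)
      then show ?thesis
        unfolding meet_at_ends_def by blast
    next
      case 3
      then show ?thesis
        using chain_sideD(3)[OF A \<open>a \<in> A\<close> that(1,2)] chain_sideD(4)[OF A \<open>a \<in> A\<close> that(1) \<open>b \<in> B\<close>] that
          chain_sideD(1)[OF A]
        by (intro meet_at_ends_separated[of s a p]) auto
    next
      case 4
      then have "0 < s * orient q a p" "s * orient q a b < 0"
        using chain_sideD(3)[OF A that(1,2) \<open>a \<in> A\<close>] chain_sideD(4)[OF A that(2) \<open>a \<in> A\<close> \<open>b \<in> B\<close>] that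
        by (auto simp: orient_rotate)
      then show ?thesis
        using chain_sideD(1)[OF A] by (intro meet_at_ends_separated[of s q a]) auto
    qed
  qed
  have "fst p \<noteq> fst q"
    using assms chain_sideD(2)[OF A] by (auto dest: inj_onD)
  then consider "fst p < fst q" | "fst q < fst p"
    by linarith
  then show ?thesis
    by cases (use * assms meet_at_ends_swap(1) in blast)+
qed

lemma meet_at_ends_opposite_chords:
  assumes A: "chain_side s A B" and "p \<in> A" "q \<in> A" "p \<noteq> q" "p' \<in> B" "q' \<in> B"
  shows "meet_at_ends p q p' q'"
proof -
  have *: "meet_at_ends p q p' q'" if "p \<in> A" "q \<in> A" "fst p < fst q" for p q
  proof -
    have b: "s * orient p q p' < 0" "s * orient p q q' < 0"
      using chain_sideD(4)[OF A] that assms(5,6) by blast+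
    have "False" if "z \<in> closed_segment p q" "z \<in> closed_segment p' q'" for z
      using closed_segment_misses_line[OF that(2), of "- s" p q] b that(1)
      by (auto simp: in_segment orient_affine)
    then show ?thesis
      unfolding meet_at_ends_def by blast
  qed
  have "fst p \<noteq> fst q"
    using assms chain_sideD(2)[OF A] by (auto dest: inj_onD)
  then consider "fst p < fst q" | "fst q < fst p"
    by linarith
  then show ?thesis
    by cases (use * assms meet_at_ends_swap(1) in blast)+
qed

text \<open>The diagonal through \<open>a\<close> and \<open>b'\<close> separates the two bridges:
  \<open>a'\<close> is on one side because of the position of \<open>b'\<close> relative to the line
  \<open>a a'\<close>, and \<open>b\<close> on the other because of the position of \<open>a\<close>
  relative to the line \<open>b b'\<close>. When the bridges share an end, the diagonal is one of
  them.\<close>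

lemma meet_at_ends_bridges:
  assumes A: "chain_side s A B" and B: "chain_side (- s) B A"
    and "a \<in> A" "a' \<in> A" "b \<in> B" "b' \<in> B" "(a, b) \<noteq> (a', b')" "fst a \<le> fst a'" "fst b \<le> fst b'"
  shows "meet_at_ends a b a' b'"
proof -
  have 1: "s * orient a b' a' \<ge> 0 \<and> (a \<noteq> a' \<longrightarrow> s * orient a b' a' > 0)"
  proof (cases "a = a'")
    case False
    then have "fst a < fst a'"
      using assms chain_sideD(2)[OF A] by (auto dest: inj_onD simp: less_le)
    then have "s * orient a a' b' < 0"
      using chain_sideD(4)[OF A] assms by blast
    then show ?thesis
      by (simp add: orient_def algebra_simps)
  qed auto
  have 2: "s * orient a b' b \<le> 0 \<and> (b \<noteq> b' \<longrightarrow> s * orient a b' b < 0)"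
  proof (cases "b = b'")
    case False
    then have "fst b < fst b'"
      using assms chain_sideD(2)[OF B] by (auto dest: inj_onD simp: less_le)
    then have "- s * orient b b' a < 0"
      using chain_sideD(4)[OF B] assms by blast
    then show ?thesis
      by (simp add: orient_def algebra_simps)
  qed auto
  consider "a \<noteq> a'" "b \<noteq> b'" | "a = a'" "b \<noteq> b'" | "a \<noteq> a'" "b = b'"
    using assms(7) by blast
  then show ?thesis
  proof cases
    case 1
    then show ?thesis
      using \<open>_ \<and> (a \<noteq> a' \<longrightarrow> _)\<close> 2 chain_sideD(1)[OF A]
      by (intro meet_at_ends_separated[of "- s" a b']) auto
  next
    case 2
    have n: "s * orient a b' b < 0"
      using \<open>s * orient a b' b \<le> 0 \<and> _\<close> 2 by blast
    then have "s \<noteq> 0" "orient a b' b \<noteq> 0"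
      by auto
    have "z \<in> {a, b} \<and> - s * orient a b' z = 0"
      if "z \<in> closed_segment a b" "z \<in> closed_segment a' b'" for z
      using closed_segment_meets_line[OF that(1), of "- s" a b'] n that(2) 2(1)
        \<open>s \<noteq> 0\<close> \<open>orient a b' b \<noteq> 0\<close>
      by (auto simp: in_segment orient_affine)
    then show ?thesis
      using n 2(1) unfolding meet_at_ends_def by fastforce
  next
    case 3
    have n: "s * orient a b' a' > 0"
      using 1 3 by blast
    then have "s \<noteq> 0" "orient a b' a' \<noteq> 0"
      by auto
    have "z \<in> {a', b'} \<and> s * orient a b' z = 0"
      if "z \<in> closed_segment a b" "z \<in> closed_segment a' b'" for z
      using closed_segment_meets_line[OF that(2), of "s" a b'] n that(1) 3(2)
        \<open>s \<noteq> 0\<close> \<open>orient a b' a' \<noteq> 0\<close>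
      by (auto simp: in_segment orient_affine)
    then show ?thesis
      using n 3(2) unfolding meet_at_ends_def by fastforce
  qed
qed

lemma on_line_if_orient_eq_0:
  assumes "orient a b z = 0" "a \<noteq> b"
  obtains t where "z = (1 - t) *\<^sub>R a + t *\<^sub>R b"
proof (cases "fst a = fst b")
  case True
  then have "snd a \<noteq> snd b" "fst z = fst a"
    using assms by (auto simp: orient_def prod_eq_iff)
  then have "(snd z - snd a) / (snd b - snd a) * (snd b - snd a) = snd z - snd a"
    by simp
  then show ?thesis
    using True \<open>fst z = fst a\<close> by (intro that[of "(snd z - snd a) / (snd b - snd a)"])
      (simp add: prod_eq_iff left_diff_distrib right_diff_distrib)
next
  case False
  then have "(fst z - fst a) / (fst b - fst a) * (fst b - fst a) = fst z - fst a"
    "(fst z - fst a) / (fst b - fst a) * (snd b - snd a) = snd z - snd a"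
    using assms(1) by (auto simp: orient_def field_simps)
  then show ?thesis
    by (intro that[of "(fst z - fst a) / (fst b - fst a)"])
      (simp add: prod_eq_iff left_diff_distrib right_diff_distrib)
qed

text \<open>Each of the two segments has its ends strictly on opposite sides of the line carrying
  the other one.\<close>

lemma bridges_cross:
  assumes A: "chain_side s A B" and B: "chain_side (- s) B A"
    and "a \<in> A" "a' \<in> A" "b \<in> B" "b' \<in> B" "fst a < fst a'" "fst b < fst b'"
  shows "closed_segment a b' \<inter> closed_segment a' b \<noteq> {}"
proof -
  have "s * orient a a' b' < 0" "s * orient a a' b < 0" "s * orient b b' a > 0" "s * orient b b' a' > 0"
    using chain_sideD(4)[OF A, of a a'] chain_sideD(4)[OF B, of b b'] assms by auto
  then have signs: "s * orient a b' a' > 0" "s * orient a b' b < 0"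
    "s * orient a' b a < 0" "s * orient a' b b' > 0"
    by (simp_all add: orient_def algebra_simps)
  \<comment> \<open>The zero of the affine function \<open>orient a b'\<close> on the segment from
    \<open>a'\<close> to \<open>b\<close>.\<close>
  define t where "t = s * orient a b' a' / (s * orient a b' a' - s * orient a b' b)"
  define z where "z = (1 - t) *\<^sub>R a' + t *\<^sub>R b"
  have zero: "(1 - x / (x - y)) * x + x / (x - y) * y = 0" if "0 < x" "y < 0" for x y :: real
    using that by (simp add: field_simps)
  have t: "0 \<le> t" "t \<le> 1"
    using signs unfolding t_def by (auto simp: field_simps)
  have "s * orient a b' z = (1 - t) * (s * orient a b' a') + t * (s * orient a b' b)"
    unfolding z_def orient_affine by (simp add: algebra_simps)
  also have "\<dots> = 0"
    using signs zero unfolding t_def by blast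
  finally have "orient a b' z = 0"
    using chain_sideD(1)[OF A] by simp
  moreover have "a \<noteq> b'"
    using signs by auto
  ultimately obtain u where u: "z = (1 - u) *\<^sub>R a + u *\<^sub>R b'"
    using on_line_if_orient_eq_0 by blast
  have "s * orient a' b z = 0"
    by (simp add: z_def orient_affine)
  then have eq: "(1 - u) * (s * orient a' b a) + u * (s * orient a' b b') = 0"
    unfolding u orient_affine by (simp add: algebra_simps)
  \<comment> \<open>For \<open>u\<close> outside the unit interval both terms of \<open>eq\<close>
    would have the same strict sign.\<close>
  have "0 \<le> u"
  proof (rule ccontr)
    assume "\<not> 0 \<le> u"
    then have "(1 - u) * (s * orient a' b a) < 0" "u * (s * orient a' b b') < 0"
      using signs by (simp_all add: mult_less_0_iff)
    then show False using eq by linarith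
  qed
  moreover have "u \<le> 1"
  proof (rule ccontr)
    assume "\<not> u \<le> 1"
    then have "(1 - u) * (s * orient a' b a) > 0" "u * (s * orient a' b b') > 0"
      using signs by (simp_all add: zero_less_mult_iff)
    then show False using eq by linarith
  qed
  ultimately have "z \<in> closed_segment a b'" "z \<in> closed_segment a' b"
    using t u z_def by (auto simp: in_segment)
  then show ?thesis
    by blast
qed

section \<open>The order type derived from the definition of a double-chain\<close>

lemma strictly_convex_orient:
  assumes "strictly_convex f" "x < y" "y < z"
  shows "0 < orient (x, f x) (y, f y) (z, f z)"
proof -
  define t where "t = (y - x) / (z - x)"
  have t: "0 < t" "t < 1" "t * (z - x) = y - x"
    using assms by (auto simp: t_def field_simps)
  have "(1 - t) * x + t * z = y"
    using t(3) by (simp add: algebra_simps)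
  then have "f y < (1 - t) * f x + t * f z"
    using assms t unfolding strictly_convex_def
    by (metis less_irrefl less_trans)
  then have "(z - x) * (f y - f x) < (z - x) * (t * (f z - f x))"
    using assms by (intro mult_strict_left_mono) (auto simp: algebra_simps)
  also have "\<dots> = (y - x) * (f z - f x)"
    by (simp add: t(3)[symmetric])
  finally show ?thesis
    by (simp add: orient_def algebra_simps)
qed

text \<open>Translates the vertical comparisons in \<open>strictly_below\<close> and
  \<open>strictly_above\<close> into signs of \<open>orient\<close>: the vertical distance from
  \<open>q\<close> to the line is scaled by the horizontal extent of \<open>a b\<close>.\<close>

lemma point_on_affine_hull_above:
  fixes a b q :: point
  assumes "fst a \<noteq> fst b"
  shows "\<exists>p \<in> affine hull {a, b}. fst p = fst q \<and>
    orient a b q = (fst b - fst a) * (snd q - snd p)"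
proof -
  define t where "t = (fst q - fst a) / (fst b - fst a)"
  have t: "t * (fst b - fst a) = fst q - fst a"
    using assms by (simp add: t_def)
  define p where "p = (1 - t) *\<^sub>R a + t *\<^sub>R b"
  have "p \<in> affine hull {a, b}"
    unfolding affine_hull_2 p_def by (intro CollectI exI[of _ "1 - t"] exI[of _ t]) auto
  moreover have f: "fst p = fst q"
    using t by (simp add: p_def algebra_simps)
  moreover have "orient a b p = 0"
    by (simp add: p_def orient_affine)
  then have "orient a b q = (fst b - fst a) * (snd q - snd p)"
    using f by (simp add: orient_def algebra_simps)
  ultimately show ?thesis
    by blast
qed

lemma double_chain_sides:
  assumes "double_chain C1 C2"
  shows "chain_side 1 C1 C2" "chain_side (- 1) C2 C1"
proof -
  obtain f where f: "strictly_convex f" "\<And>p. p \<in> C1 \<Longrightarrow> snd p = f (fst p)"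
    using assms by (auto simp: double_chain_def convex_chain_def)
  obtain g where g: "strictly_convex (\<lambda>x. - g x)" "\<And>p. p \<in> C2 \<Longrightarrow> snd p = g (fst p)"
    using assms by (auto simp: double_chain_def concave_chain_def strictly_concave_def)
  have below: "strictly_below q (affine hull {a, b})" if "q \<in> C2" "a \<in> C1" "b \<in> C1" "a \<noteq> b" for q a b
    using assms that by (auto simp: double_chain_def)
  have above: "strictly_above q (affine hull {a, b})" if "q \<in> C1" "a \<in> C2" "b \<in> C2" "a \<noteq> b" for q a b
    using assms that by (auto simp: double_chain_def)
  show "chain_side 1 C1 C2"
    unfolding chain_side_def
  proof (intro conjI ballI impI)
    show "inj_on fst C1"
      using f(2) by (auto simp: inj_on_def prod_eq_iff)
    show "0 < 1 * orient a a' a''"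
      if "a \<in> C1" "a' \<in> C1" "a'' \<in> C1" "fst a < fst a'" "fst a' < fst a''" for a a' a''
      using strictly_convex_orient[OF f(1) that(4,5)] that(1-3)[THEN f(2), symmetric] by simp
    show "1 * orient a a' b < 0"
      if *: "a \<in> C1" "a' \<in> C1" "fst a < fst a'" "b \<in> C2" for a a' b
    proof -
      obtain p where p: "p \<in> affine hull {a, a'}" "fst p = fst b"
        "orient a a' b = (fst a' - fst a) * (snd b - snd p)"
        using point_on_affine_hull_above[of a a' b] * by auto
      have "snd b < snd p"
        using below[of b a a'] * p by (auto simp: strictly_below_def)
      then show ?thesis
        using p(3) * by (simp add: mult_pos_neg)
    qed
  qed simp
  show "chain_side (- 1) C2 C1"
    unfolding chain_side_def
  proof (intro conjI ballI impI)
    show "inj_on fst C2"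
      using g(2) by (auto simp: inj_on_def prod_eq_iff)
    show "0 < - 1 * orient a a' a''"
      if "a \<in> C2" "a' \<in> C2" "a'' \<in> C2" "fst a < fst a'" "fst a' < fst a''" for a a' a''
      using strictly_convex_orient[OF g(1) that(4,5)] that(1-3)[THEN g(2)]
      by (simp add: orient_def algebra_simps)
    show "- 1 * orient a a' b < 0"
      if *: "a \<in> C2" "a' \<in> C2" "fst a < fst a'" "b \<in> C1" for a a' b
    proof -
      obtain p where p: "p \<in> affine hull {a, a'}" "fst p = fst b"
        "orient a a' b = (fst a' - fst a) * (snd b - snd p)"
        using point_on_affine_hull_above[of a a' b] * by auto
      have "snd p < snd b"
        using above[of b a a'] * p by (auto simp: strictly_above_def)
      then show ?thesis
        using p(3) * by simp
    qed
  qed simp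
qed

section \<open>Noncrossing drawings on a double-chain\<close>

text \<open>Induction removing a pair \<open>x0\<close>, \<open>w0\<close> at minimal distance. Any
  value of \<open>f\<close> or \<open>h\<close> strictly between its two ends would give a closer
  pair, so this pair is innermost with respect to all others. \<open>f\<close> need not be
  injective, since several leaves may hang on one vertex.\<close>

lemma noncrossing_matching:
  fixes h :: "'w \<Rightarrow> real" and f :: "'r \<Rightarrow> real"
  assumes "finite W" "finite R" "card R = card W"
  shows "\<exists>g. bij_betw g R W \<and> (\<forall>x\<in>R. \<forall>y\<in>R. x \<noteq> y \<longrightarrow>
    f x \<notin> open_segment (f y) (h (g y)) \<and> h (g x) \<notin> open_segment (f y) (h (g y)) \<or>
    f y \<notin> open_segment (f x) (h (g x)) \<and> h (g y) \<notin> open_segment (f x) (h (g x)))"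
  using assms
proof (induction "card W" arbitrary: W R)
  case 0
  then show ?case
    by (auto simp: bij_betw_def)
next
  case (Suc n)
  then have "R \<times> W \<noteq> {}" "finite (R \<times> W)"
    by auto
  then obtain x0 w0 where x0: "x0 \<in> R" "w0 \<in> W"
    and closest: "\<And>x w. x \<in> R \<Longrightarrow> w \<in> W \<Longrightarrow> \<bar>f x0 - h w0\<bar> \<le> \<bar>f x - h w\<bar>"
    using ex_is_arg_min_if_finite[of "R \<times> W" "\<lambda>(x, w). \<bar>f x - h w\<bar>"]
    by (fastforce simp: is_arg_min_def not_less)
  have f: "f x \<notin> open_segment (f x0) (h w0)" if "x \<in> R" for x
    using closest[OF that x0(2)] by (auto simp: open_segment_eq_real_ivl split: if_splits)
  have h: "h w \<notin> open_segment (f x0) (h w0)" if "w \<in> W" for w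
    using closest[OF x0(1) that] by (auto simp: open_segment_eq_real_ivl split: if_splits)
  have "n = card (W - {w0})" "card (R - {x0}) = card (W - {w0})"
    using Suc.hyps(2) Suc.prems x0 by auto
  from Suc.hyps(1)[OF this(1) _ _ this(2)] Suc.prems obtain g where g: "bij_betw g (R - {x0}) (W - {w0})"
    "\<forall>x\<in>R - {x0}. \<forall>y\<in>R - {x0}. x \<noteq> y \<longrightarrow>
      f x \<notin> open_segment (f y) (h (g y)) \<and> h (g x) \<notin> open_segment (f y) (h (g y)) \<or>
      f y \<notin> open_segment (f x) (h (g x)) \<and> h (g y) \<notin> open_segment (f x) (h (g x))"
    by auto
  have "g x \<in> W" if "x \<in> R" "x \<noteq> x0" for x
    using g(1) that by (auto simp: bij_betw_def)
  moreover have "bij_betw (g(x0 := w0)) R W"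
  proof -
    have "bij_betw (g(x0 := w0)) (R - {x0}) (W - {w0})"
      using g(1) by (rule bij_betw_cong[THEN iffD1, rotated]) auto
    then have "bij_betw (g(x0 := w0)) (R - {x0} \<union> {x0}) (W - {w0} \<union> {w0})"
      by (intro bij_betw_combine) auto
    then show ?thesis
      using x0 by (simp add: insert_absorb)
  qed
  ultimately show ?case
    using g(2) f h by (intro exI[of _ "g(x0 := w0)"]) auto
qed

lemma ex_monotone_bij:
  fixes r :: "'a \<Rightarrow> real" and h :: "'b \<Rightarrow> real"
  assumes "finite A" "finite B" "card A = card B" "inj_on r A" "inj_on h B"
  shows "\<exists>g. bij_betw g A B \<and> (\<forall>x\<in>A. \<forall>y\<in>A. r x \<le> r y \<longrightarrow> h (g x) \<le> h (g y))"
  using assms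
proof (induction "card A" arbitrary: A B)
  case 0
  then show ?case
    by (auto simp: bij_betw_def)
next
  case (Suc n)
  then have "A \<noteq> {}" "B \<noteq> {}"
    by auto
  then obtain a b where a: "a \<in> A" "\<And>x. x \<in> A \<Longrightarrow> r x \<le> r a"
    and b: "b \<in> B" "\<And>x. x \<in> B \<Longrightarrow> h x \<le> h b"
    using ex_is_arg_min_if_finite[of A "\<lambda>x. - r x"] ex_is_arg_min_if_finite[of B "\<lambda>x. - h x"] Suc.prems
    by (auto simp: is_arg_min_linorder)
  have "n = card (A - {a})" "card (A - {a}) = card (B - {b})"
    using Suc a b by auto
  from Suc.hyps(1)[OF this(1) _ _ this(2)] Suc.prems obtain g where g: "bij_betw g (A - {a}) (B - {b})"
    "\<forall>x\<in>A - {a}. \<forall>y\<in>A - {a}. r x \<le> r y \<longrightarrow> h (g x) \<le> h (g y)"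
    by (auto intro: inj_on_diff)
  have "g x \<in> B" if "x \<in> A" "x \<noteq> a" for x
    using g(1) that by (auto simp: bij_betw_def)
  moreover have "bij_betw (g(a := b)) A B"
  proof -
    have "bij_betw (g(a := b)) (A - {a}) (B - {b})"
      using g(1) by (rule bij_betw_cong[THEN iffD1, rotated]) auto
    then have "bij_betw (g(a := b)) (A - {a} \<union> {a}) (B - {b} \<union> {b})"
      by (intro bij_betw_combine) auto
    then show ?thesis
      using a b by (simp add: insert_absorb)
  qed
  moreover have "x = a" if "x \<in> A" "r a \<le> r x" for x
    using that a inj_onD[OF Suc.prems(4), of x a] by (simp add: order_antisym)
  ultimately show ?case
    using g(2) a b by (intro exI[of _ "g(a := b)"]) auto
qed

text \<open>
  The edges can be drawn without crossings between two parallel lines carrying the two color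
  classes, \<open>r\<close> being the position on the line.
\<close>

definition two_layer :: "('a, 'b) pre_digraph \<Rightarrow> ('a \<Rightarrow> color) \<Rightarrow> ('a \<Rightarrow> real) \<Rightarrow> bool" where
  "two_layer G c r \<longleftrightarrow>
     (\<forall>k. inj_on r (color_class (verts G) c k)) \<and>
     (\<forall>u v x y. u \<rightarrow>\<^bsub>G\<^esub> v \<longrightarrow> x \<rightarrow>\<^bsub>G\<^esub> y \<longrightarrow> c u = c x \<longrightarrow> r u < r x \<longrightarrow> r v \<le> r y)"

lemma color_cases: "(k :: color) \<noteq> k' \<Longrightarrow> j = k \<or> j = k'"
  by (cases j; cases k; cases k'; simp)

lemma color_class_simps:
  "x \<in> color_class A c k \<longleftrightarrow> x \<in> A \<and> c x = k"
  "color_class (A \<union> B) c k = color_class A c k \<union> color_class B c k"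
  "color_class (A - B) c k = color_class A c k - color_class B c k"
  "finite A \<Longrightarrow> finite (color_class A c k)"
  by (auto simp: color_class_def)

lemma color_class_split: "k \<noteq> k' \<Longrightarrow> color_class A c k \<union> color_class A c k' = A"
  using color_cases[of k k'] by (auto simp: color_class_def)

lemma card_color_classes:
  assumes "finite A" "k \<noteq> k'"
  shows "card A = card (color_class A c k) + card (color_class A c k')"
proof -
  have "color_class A c k \<inter> color_class A c k' = {}"
    using assms(2) by (auto simp: color_class_def)
  then show ?thesis
    using assms(1) color_class_split[OF assms(2), of A c] by (metis card_Un_disjoint finite_Un)
qed

lemma compatible_coloring_card:
  assumes "compatible_coloring G c S d" "finite (verts G)"
  shows "card (color_class S d k) = card (color_class (verts G) c k)"
  using assms card_color_classes[of S Black White d] card_color_classes[of "verts G" Black White c]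
  by (cases k) (auto simp: compatible_coloring_def)

text \<open>
  \<open>R\<close> occupies the points of the minority colors (\<open>k'\<close> in \<open>C1\<close>, \<open>k\<close> in \<open>C2\<close>). The rest of the graph
  is drawn between the chains, and each vertex of \<open>R\<close> is joined to its neighbor inside a chain.
\<close>

lemma embeddable_double_chain:
  fixes G :: "('a, 'b) pre_digraph"
  assumes "graph G" and dc: "double_chain C1 C2" and proper: "proper_coloring G c"
    and compat: "compatible_coloring G c (C1 \<union> C2) d" and layers: "two_layer G c r"
    and "R \<subseteq> verts G" and R_indep: "\<And>u v. u \<in> R \<Longrightarrow> u \<rightarrow>\<^bsub>G\<^esub> v \<Longrightarrow> v \<notin> R"
    and R_unique: "\<And>u v w. u \<in> R \<Longrightarrow> u \<rightarrow>\<^bsub>G\<^esub> v \<Longrightarrow> u \<rightarrow>\<^bsub>G\<^esub> w \<Longrightarrow> v = w"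
    and k: "k \<noteq> k'"
    and card_R: "card (color_class R c k') = card (color_class C1 d k')"
      "card (color_class R c k) = card (color_class C2 d k)"
  shows "embeddable G c (C1 \<union> C2) d"
proof -
  interpret graph G by fact
  note side1 = double_chain_sides(1)[OF dc] and side2 = double_chain_sides(2)[OF dc]
  note inj1 = chain_sideD(2)[OF side1] and inj2 = chain_sideD(2)[OF side2]
  have fin: "finite C1" "finite C2" "finite R" "C1 \<inter> C2 = {}"
    using dc \<open>R \<subseteq> _\<close> finite_subset[OF _ finite_verts]
    by (auto simp: double_chain_def convex_chain_def concave_chain_def)
  \<comment> \<open>The vertices drawn between the chains: \<open>A k\<close> will occupy the points
    of color \<open>k\<close> on \<open>C1\<close>, and \<open>A k'\<close> those of color
    \<open>k'\<close> on \<open>C2\<close>.\<close>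
  define A where "A = color_class (verts G - R) c"
  have A_iff: "v \<in> A j \<longleftrightarrow> v \<in> verts G \<and> v \<notin> R \<and> c v = j" for v j
    by (auto simp: A_def color_class_simps)
  have total: "card (A j) + card (color_class R c j) =
      card (color_class C1 d j) + card (color_class C2 d j)" for j
  proof -
    have "card (color_class R c j) \<le> card (color_class (verts G) c j)"
      using \<open>R \<subseteq> _\<close> by (intro card_mono) (auto simp: color_class_simps)
    then have "card (A j) + card (color_class R c j) = card (color_class (verts G) c j)"
      using \<open>R \<subseteq> _\<close> fin unfolding A_def color_class_simps
      by (subst card_Diff_subset) (auto simp: color_class_simps)
    also have "\<dots> = card (color_class C1 d j \<union> color_class C2 d j)"
      using compatible_coloring_card[OF compat] by (simp add: color_class_simps)
    also have "\<dots> = card (color_class C1 d j) + card (color_class C2 d j)"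
      using fin by (intro card_Un_disjoint) (auto simp: color_class_simps(4) color_class_def)
    finally show ?thesis .
  qed
  have fin_c: "finite (A j)" "finite (color_class R c j)" "finite (color_class C1 d j)"
    "finite (color_class C2 d j)" for j
    using fin by (auto simp: A_def color_class_simps)
  have inj_r: "inj_on r (A j)" for j
    using layers unfolding two_layer_def A_def color_class_simps(3) by (blast intro: inj_on_diff)
  have "inj_on fst (color_class C1 d k)" "inj_on fst (color_class C2 d k')"
    using inj1 inj2 by (auto intro: inj_on_subset simp: color_class_def)
  moreover have "card (A k) = card (color_class C1 d k)" "card (A k') = card (color_class C2 d k')"
    using total[of k] total[of k'] card_R by simp_all
  ultimately have "\<exists>g. bij_betw g (A k) (color_class C1 d k) \<and>
      (\<forall>x\<in>A k. \<forall>y\<in>A k. r x \<le> r y \<longrightarrow> fst (g x) \<le> fst (g y))"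
    "\<exists>g. bij_betw g (A k') (color_class C2 d k') \<and>
      (\<forall>x\<in>A k'. \<forall>y\<in>A k'. r x \<le> r y \<longrightarrow> fst (g x) \<le> fst (g y))"
    using fin_c inj_r by (intro ex_monotone_bij; simp)+
  then obtain g1 g2 where
    g1: "bij_betw g1 (A k) (color_class C1 d k)"
      "\<forall>x\<in>A k. \<forall>y\<in>A k. r x \<le> r y \<longrightarrow> fst (g1 x) \<le> fst (g1 y)" and
    g2: "bij_betw g2 (A k') (color_class C2 d k')"
      "\<forall>x\<in>A k'. \<forall>y\<in>A k'. r x \<le> r y \<longrightarrow> fst (g2 x) \<le> fst (g2 y)"
    by (elim exE conjE)
  \<comment> \<open>An isolated vertex of \<open>R\<close> gets an arbitrary parent. It still has to
    occupy a point, but no segment is drawn to it.\<close>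
  define parent where "parent u = (SOME v. u \<rightarrow>\<^bsub>G\<^esub> v)" for u
  have parent: "parent u = v" if "u \<in> R" "u \<rightarrow>\<^bsub>G\<^esub> v" for u v
    unfolding parent_def using that R_unique by (intro some_equality) auto
  let ?nested = "\<lambda>g f x y. f x \<notin> open_segment (f y) (fst (g y)) \<and> fst (g x) \<notin> open_segment (f y) (fst (g y)) \<or>
    f y \<notin> open_segment (f x) (fst (g x)) \<and> fst (g y) \<notin> open_segment (f x) (fst (g x))"
  have "\<exists>g. bij_betw g (color_class R c k') (color_class C1 d k') \<and>
      (\<forall>x\<in>color_class R c k'. \<forall>y\<in>color_class R c k'. x \<noteq> y \<longrightarrow>
        ?nested g (\<lambda>u. fst (g1 (parent u))) x y)"
    using fin_c card_R by (intro noncrossing_matching)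
  then obtain g3 where g3: "bij_betw g3 (color_class R c k') (color_class C1 d k')"
    "\<forall>x\<in>color_class R c k'. \<forall>y\<in>color_class R c k'. x \<noteq> y \<longrightarrow>
      ?nested g3 (\<lambda>u. fst (g1 (parent u))) x y"
    by (elim exE conjE)
  have "\<exists>g. bij_betw g (color_class R c k) (color_class C2 d k) \<and>
      (\<forall>x\<in>color_class R c k. \<forall>y\<in>color_class R c k. x \<noteq> y \<longrightarrow>
        ?nested g (\<lambda>u. fst (g2 (parent u))) x y)"
    using fin_c card_R by (intro noncrossing_matching)
  then obtain g4 where g4: "bij_betw g4 (color_class R c k) (color_class C2 d k)"
    "\<forall>x\<in>color_class R c k. \<forall>y\<in>color_class R c k. x \<noteq> y \<longrightarrow>
      ?nested g4 (\<lambda>u. fst (g2 (parent u))) x y"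
    by (elim exE conjE)
  \<comment> \<open>In \<open>R\<close> the colors swap chains: the neighbor of a vertex of
    \<open>R\<close> of color \<open>k'\<close> is in \<open>A k\<close>, hence on
    \<open>C1\<close>, and the vertex goes to \<open>C1\<close> as well, so that their edge becomes
    a chord.\<close>
  define \<phi> where "\<phi> v = (if v \<in> R then if c v = k then g4 v else g3 v
    else if c v = k then g1 v else g2 v)" for v
  have \<phi>: "v \<in> A k \<Longrightarrow> \<phi> v = g1 v" "v \<in> A k' \<Longrightarrow> \<phi> v = g2 v"
    "v \<in> color_class R c k' \<Longrightarrow> \<phi> v = g3 v" "v \<in> color_class R c k \<Longrightarrow> \<phi> v = g4 v" for v
    using k by (auto simp: \<phi>_def A_iff color_class_simps)
  have bij_parts: "bij_betw \<phi> (A k) (color_class C1 d k)" "bij_betw \<phi> (A k') (color_class C2 d k')"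
    "bij_betw \<phi> (color_class R c k') (color_class C1 d k')"
    "bij_betw \<phi> (color_class R c k) (color_class C2 d k)"
    using g1(1) g2(1) g3(1) g4(1) bij_betw_cong[of _ \<phi>] \<phi> by metis+
  have "bij_betw \<phi> ((A k \<union> color_class R c k') \<union> (A k' \<union> color_class R c k))
      ((color_class C1 d k \<union> color_class C1 d k') \<union> (color_class C2 d k' \<union> color_class C2 d k))"
    using bij_parts k fin(4) by (intro bij_betw_combine) (auto simp: color_class_simps)
  moreover have "(A k \<union> color_class R c k') \<union> (A k' \<union> color_class R c k) = verts G"
    using \<open>R \<subseteq> _\<close> color_class_split[OF k, of "verts G - R" c] color_class_split[OF k, of R c]
    unfolding A_def by blast
  moreover have "(color_class C1 d k \<union> color_class C1 d k') \<union> (color_class C2 d k' \<union> color_class C2 d k)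
      = C1 \<union> C2"
    using color_class_split[OF k, of C1 d] color_class_split[OF k, of C2 d] by blast
  ultimately have bij: "bij_betw \<phi> (verts G) (C1 \<union> C2)"
    by simp
  then have inj: "\<phi> u = \<phi> v \<longleftrightarrow> u = v" if "u \<in> verts G" "v \<in> verts G" for u v
    using that by (auto simp: bij_betw_def dest: inj_onD)
  have img: "v \<in> A k \<Longrightarrow> \<phi> v \<in> color_class C1 d k" "v \<in> A k' \<Longrightarrow> \<phi> v \<in> color_class C2 d k'"
    "v \<in> color_class R c k' \<Longrightarrow> \<phi> v \<in> color_class C1 d k'"
    "v \<in> color_class R c k \<Longrightarrow> \<phi> v \<in> color_class C2 d k" for v
    using bij_parts by (auto simp: bij_betw_def)
  have color: "d (\<phi> v) = c v" if v: "v \<in> verts G" for v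
  proof -
    consider "v \<in> A k" | "v \<in> A k'" | "v \<in> color_class R c k'" | "v \<in> color_class R c k"
      using v color_cases[OF k, of "c v"] unfolding A_iff color_class_simps by blast
    then show ?thesis
      by cases (use img[of v] in \<open>simp_all add: A_iff color_class_simps\<close>)
  qed
  define bridge where "bridge u v \<longleftrightarrow> u \<in> A k \<and> v \<in> A k' \<and> u \<rightarrow>\<^bsub>G\<^esub> v" for u v
  define chord1 where "chord1 u v \<longleftrightarrow> u \<in> color_class R c k' \<and> v \<in> A k \<and> u \<rightarrow>\<^bsub>G\<^esub> v" for u v
  define chord2 where "chord2 u v \<longleftrightarrow> u \<in> color_class R c k \<and> v \<in> A k' \<and> u \<rightarrow>\<^bsub>G\<^esub> v" for u v
  define meet where "meet u v x y \<longleftrightarrow> meet_at_ends (\<phi> u) (\<phi> v) (\<phi> x) (\<phi> y)" for u v x y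
  have meet_swap: "meet u v x y \<longleftrightarrow> meet v u x y" "meet u v x y \<longleftrightarrow> meet u v y x"
    "meet u v x y \<longleftrightarrow> meet x y u v" for u v x y
    unfolding meet_def by (fact meet_at_ends_swap meet_at_ends_commute)+
  have meet_sym: "meet x y u v \<Longrightarrow> meet u v x y" for u v x y
    by (simp only: meet_swap(3)[of u v x y])
  have edge_cases: "bridge u v \<or> chord1 u v \<or> chord2 u v \<or> bridge v u \<or> chord1 v u \<or> chord2 v u"
    if "u \<rightarrow>\<^bsub>G\<^esub> v" for u v
  proof -
    have "v \<rightarrow>\<^bsub>G\<^esub> u" "u \<in> verts G" "v \<in> verts G" "c u \<noteq> c v"
      using that graph_symmetric adj_in_verts proper by (auto simp: proper_coloring_def)
    moreover have "\<not> (u \<in> R \<and> v \<in> R)"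
      using R_indep that by blast
    ultimately show ?thesis
      using that color_cases[OF k, of "c u"] color_cases[OF k, of "c v"]
      unfolding bridge_def chord1_def chord2_def A_iff color_class_simps by auto
  qed
  have in_V: "u \<in> verts G \<and> v \<in> verts G \<and> u \<noteq> v" if "u \<rightarrow>\<^bsub>G\<^esub> v" for u v
    using that adj_in_verts adj_not_same by blast
  have bb: "meet u v x y" if "bridge u v" "bridge x y" "(u, v) \<noteq> (x, y)" for u v x y
  proof -
    have *: "meet u v x y" if "bridge u v" "bridge x y" "(u, v) \<noteq> (x, y)" "r u \<le> r x" "r v \<le> r y" for u v x y
    proof -
      have uv: "u \<in> A k" "v \<in> A k'" "x \<in> A k" "y \<in> A k'"
        using that by (auto simp: bridge_def)
      then have "\<phi> u \<in> C1" "\<phi> x \<in> C1" "\<phi> v \<in> C2" "\<phi> y \<in> C2"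
        using img by (auto simp: color_class_simps)
      moreover have "fst (\<phi> u) \<le> fst (\<phi> x)" "fst (\<phi> v) \<le> fst (\<phi> y)"
        using g1(2)[rule_format, of u x] g2(2)[rule_format, of v y] uv that \<phi> by simp_all
      moreover have "(\<phi> u, \<phi> v) \<noteq> (\<phi> x, \<phi> y)"
        using that inj uv by (auto simp: A_iff)
      ultimately show ?thesis
        unfolding meet_def by (intro meet_at_ends_bridges[OF side1 side2])
    qed
    have "c u = c x" "c v = c y" "u \<rightarrow>\<^bsub>G\<^esub> v" "x \<rightarrow>\<^bsub>G\<^esub> y" "u \<in> A k" "x \<in> A k"
      using that by (auto simp: bridge_def A_iff)
    \<comment> \<open>\<open>two_layer\<close> compares only edges with different starting
      positions; for a common start either order of \<open>v\<close> and \<open>y\<close> will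
      do.\<close>
    moreover have "u = x" if "r u = r x"
      using inj_r[of k] that calculation by (auto dest: inj_onD)
    ultimately have "r u \<le> r x \<and> r v \<le> r y \<or> r x \<le> r u \<and> r y \<le> r v"
      using layers unfolding two_layer_def by (metis linorder_less_linear nle_le order_less_imp_le)
    then show ?thesis
      using *[OF that] *[OF that(2,1)] that(3) meet_swap(3)[of u v x y] by auto
  qed
  have bc1: "meet u v x y" if "chord1 u v" "bridge x y" for u v x y
  proof -
    have "\<phi> u \<in> C1" "\<phi> v \<in> C1" "\<phi> x \<in> C1" "\<phi> y \<in> C2"
      using that img by (auto simp: bridge_def chord1_def color_class_simps)
    then show ?thesis
      using meet_at_ends_chord_bridge[OF side1, of "\<phi> x" "\<phi> y" "\<phi> u" "\<phi> v"] that inj in_V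
      unfolding meet_def chord1_def by blast
  qed
  have bc2: "meet u v x y" if "chord2 u v" "bridge x y" for u v x y
  proof -
    have "\<phi> u \<in> C2" "\<phi> v \<in> C2" "\<phi> x \<in> C1" "\<phi> y \<in> C2"
      using that img by (auto simp: bridge_def chord2_def color_class_simps)
    then have "meet u v y x"
      using meet_at_ends_chord_bridge[OF side2, of "\<phi> y" "\<phi> x" "\<phi> u" "\<phi> v"] that inj in_V
      unfolding meet_def chord2_def by blast
    then show ?thesis
      by (simp only: meet_swap(2)[of u v x y])
  qed
  have c12: "meet u v x y" if "chord1 u v" "chord2 x y" for u v x y
  proof -
    have "\<phi> u \<in> C1" "\<phi> v \<in> C1" "\<phi> x \<in> C2" "\<phi> y \<in> C2"
      using that img by (auto simp: chord1_def chord2_def color_class_simps)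
    then show ?thesis
      using meet_at_ends_opposite_chords[OF side1, of "\<phi> u" "\<phi> v" "\<phi> x" "\<phi> y"] that inj in_V
      unfolding meet_def chord1_def by blast
  qed
  have same: "meet u v x y"
    if side: "chain_side s C D" and C: "\<phi> u \<in> C" "\<phi> v \<in> C" "\<phi> x \<in> C" "\<phi> y \<in> C"
      and e: "u \<rightarrow>\<^bsub>G\<^esub> v" "x \<rightarrow>\<^bsub>G\<^esub> y" "{u, v} \<noteq> {x, y}"
      and n: "?nested \<phi> (\<lambda>u. fst (\<phi> (parent u))) u x" "u \<in> R" "x \<in> R"
    for s C D u v x y
  proof -
    have ne: "\<phi> u \<noteq> \<phi> v" "\<phi> x \<noteq> \<phi> y" "{\<phi> u, \<phi> v} \<noteq> {\<phi> x, \<phi> y}"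
      using e in_V inj by (auto simp: doubleton_eq_iff)
    have p: "parent u = v" "parent x = y"
      using parent n e by auto
    consider
      "fst (\<phi> u) \<notin> open_segment (fst (\<phi> x)) (fst (\<phi> y))" "fst (\<phi> v) \<notin> open_segment (fst (\<phi> x)) (fst (\<phi> y))"
      | "fst (\<phi> x) \<notin> open_segment (fst (\<phi> u)) (fst (\<phi> v))" "fst (\<phi> y) \<notin> open_segment (fst (\<phi> u)) (fst (\<phi> v))"
      using n(1) unfolding p open_segment_commute[of "fst (\<phi> v)" "fst (\<phi> u)"]
        open_segment_commute[of "fst (\<phi> y)" "fst (\<phi> x)"] by blast
    then show ?thesis
    proof cases
      case 1
      then show ?thesis
        unfolding meet_def by (rule meet_at_ends_same_chain[OF side C ne])
    next
      case 2
      then have "meet x y u v"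
        unfolding meet_def by (rule meet_at_ends_same_chain[OF side C(3,4,1,2) ne(2,1) ne(3)[symmetric]])
      then show ?thesis
        by (rule meet_sym)
    qed
  qed
  have c11: "meet u v x y" if e: "chord1 u v" "chord1 x y" "{u, v} \<noteq> {x, y}" for u v x y
  proof -
    have C: "\<phi> u \<in> C1" "\<phi> v \<in> C1" "\<phi> x \<in> C1" "\<phi> y \<in> C1"
      using e img by (auto simp: chord1_def color_class_simps)
    have p: "parent u = v" "parent x = y" "u \<in> R" "x \<in> R"
      using e parent by (auto simp: chord1_def color_class_simps)
    have "u \<noteq> x"
      using e(3) p by auto
    have R: "u \<in> color_class R c k'" "x \<in> color_class R c k'"
      using e by (simp_all add: chord1_def)
    have "?nested g3 (\<lambda>u. fst (g1 (parent u))) u x"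
      by (rule g3(2)[rule_format, OF R \<open>u \<noteq> x\<close>])
    moreover have "\<phi> u = g3 u" "\<phi> x = g3 x" "\<phi> v = g1 v" "\<phi> y = g1 y"
      using e by (simp_all add: chord1_def \<phi>)
    ultimately have n: "?nested \<phi> (\<lambda>u. fst (\<phi> (parent u))) u x"
      by (simp only: p)
    show ?thesis
      using e by (intro same[OF side1 C _ _ e(3) n p(3,4)]) (auto simp: chord1_def)
  qed
  have c22: "meet u v x y" if e: "chord2 u v" "chord2 x y" "{u, v} \<noteq> {x, y}" for u v x y
  proof -
    have C: "\<phi> u \<in> C2" "\<phi> v \<in> C2" "\<phi> x \<in> C2" "\<phi> y \<in> C2"
      using e img by (auto simp: chord2_def color_class_simps)
    have p: "parent u = v" "parent x = y" "u \<in> R" "x \<in> R"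
      using e parent by (auto simp: chord2_def color_class_simps)
    have "u \<noteq> x"
      using e(3) p by auto
    have R: "u \<in> color_class R c k" "x \<in> color_class R c k"
      using e by (simp_all add: chord2_def)
    have "?nested g4 (\<lambda>u. fst (g2 (parent u))) u x"
      by (rule g4(2)[rule_format, OF R \<open>u \<noteq> x\<close>])
    moreover have "\<phi> u = g4 u" "\<phi> x = g4 x" "\<phi> v = g2 v" "\<phi> y = g2 y"
      using e by (simp_all add: chord2_def \<phi>)
    ultimately have n: "?nested \<phi> (\<lambda>u. fst (\<phi> (parent u))) u x"
      by (simp only: p)
    show ?thesis
      using e by (intro same[OF side2 C _ _ e(3) n p(3,4)]) (auto simp: chord2_def)
  qed
  define edge where "edge u v \<longleftrightarrow> bridge u v \<or> chord1 u v \<or> chord2 u v" for u v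
  have "meet u v x y" if "edge u v" "edge x y" "{u, v} \<noteq> {x, y}" for u v x y
  proof -
    have "(u, v) \<noteq> (x, y)"
      using that(3) by auto
    then show ?thesis
      using that(1,2) unfolding edge_def
      by - (elim disjE; (rule bb c11[OF _ _ that(3)] c22[OF _ _ that(3)] bc1 bc2 c12
        bc1[THEN meet_sym] bc2[THEN meet_sym] c12[THEN meet_sym]; assumption))
  qed
  note edges = this
  have "meet u v x y" if "u \<rightarrow>\<^bsub>G\<^esub> v" "x \<rightarrow>\<^bsub>G\<^esub> y" "{u, v} \<noteq> {x, y}" for u v x y
  proof -
    have ne: "{v, u} \<noteq> {x, y}" "{u, v} \<noteq> {y, x}" "{v, u} \<noteq> {y, x}"
      using that(3) by (simp_all add: insert_commute)
    have "edge u v \<or> edge v u" "edge x y \<or> edge y x"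
      using edge_cases[OF that(1)] edge_cases[OF that(2)] unfolding edge_def by argo+
    then consider "edge u v" "edge x y" | "edge v u" "edge x y" | "edge u v" "edge y x" | "edge v u" "edge y x"
      by argo
    then show ?thesis
    proof cases
      case 1
      then show ?thesis
        by (rule edges[OF _ _ that(3)])
    next
      case 2
      then have "meet v u x y"
        by (rule edges[OF _ _ ne(1)])
      then show ?thesis
        by (simp only: meet_swap(1)[of u v x y])
    next
      case 3
      then have "meet u v y x"
        by (rule edges[OF _ _ ne(2)])
      then show ?thesis
        by (simp only: meet_swap(2)[of u v x y])
    next
      case 4
      then have "meet v u y x"
        by (rule edges[OF _ _ ne(3)])
      then show ?thesis
        by (simp only: meet_swap(1)[of u v x y] meet_swap(2)[of v u x y])
    qed
  qed
  then have "noncrossing G \<phi>"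
    by (simp add: noncrossing_def meet_def meet_at_ends_def)
  with bij color show ?thesis
    unfolding embeddable_def by (intro exI[of _ \<phi>]) simp
qed

section \<open>Vertex covers whose complement has degrees at most 1, and the count of points\<close>

definition leaf_cover :: "('a, 'b) pre_digraph \<Rightarrow> 'a set \<Rightarrow> bool" where
  "leaf_cover G Z \<longleftrightarrow> Z \<subseteq> verts G \<and> (\<forall>u v. u \<rightarrow>\<^bsub>G\<^esub> v \<longrightarrow> u \<in> Z \<or> v \<in> Z) \<and>
     (\<forall>u v w. u \<notin> Z \<longrightarrow> u \<rightarrow>\<^bsub>G\<^esub> v \<longrightarrow> u \<rightarrow>\<^bsub>G\<^esub> w \<longrightarrow> v = w)"

lemma proper_coloringD: "proper_coloring G c \<Longrightarrow> u \<rightarrow>\<^bsub>G\<^esub> v \<Longrightarrow> c u \<noteq> c v"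
  by (simp add: proper_coloring_def)

lemma card_color_class_Diff:
  assumes "finite V" "Z \<subseteq> V"
  shows "card (color_class (V - Z) c k) + card (color_class Z c k) = card (color_class V c k)"
proof -
  have "color_class Z c k \<subseteq> color_class V c k"
    using assms(2) by (auto simp: color_class_def)
  moreover have "finite (color_class V c k)"
    using assms(1) by (simp add: color_class_simps)
  ultimately show ?thesis
    unfolding color_class_simps(3) by (metis card_Diff_subset card_mono finite_subset le_add_diff_inverse2)
qed

lemma double_chain_counts:
  assumes "double_chain C1 C2" "compatible_coloring G c (C1 \<union> C2) d" "finite (verts G)"
  shows "card (color_class C1 d k) + card (color_class C2 d k) = card (color_class (verts G) c k)"
    "finite C1" "finite C2"
proof -
  show fin: "finite C1" "finite C2"
    using assms(1) by (auto simp: double_chain_def convex_chain_def concave_chain_def)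
  have "C1 \<inter> C2 = {}"
    using assms(1) by (auto simp: double_chain_def)
  then have "color_class C1 d k \<inter> color_class C2 d k = {}"
    by (auto simp: color_class_def)
  then show "card (color_class C1 d k) + card (color_class C2 d k) = card (color_class (verts G) c k)"
    using compatible_coloring_card[OF assms(2,3), of k] fin
    by (simp add: color_class_simps card_Un_disjoint)
qed

text \<open>Any subset of the complement of \<open>Z\<close> can be put aside, as this complement is
  independent with degrees at most 1. As many vertices of color \<open>k'\<close> are required there
  as \<open>C1\<close> has points of that color. The totals of color \<open>k'\<close> agree, so
  there are enough of them exactly if the color \<open>k'\<close> part of \<open>Z\<close> fits on
  \<open>C2\<close>; likewise for \<open>k\<close>.\<close>

lemma embeddable_if_leaf_cover:
  fixes G :: "('a, 'b) pre_digraph"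
  assumes "graph G" and dc: "double_chain C1 C2" and proper: "proper_coloring G c"
    and compat: "compatible_coloring G c (C1 \<union> C2) d" and layers: "two_layer G c r"
    and Z: "leaf_cover G Z" and k: "k \<noteq> k'"
    and card_Z: "card (color_class Z c k) \<le> card (color_class C1 d k)"
      "card (color_class Z c k') \<le> card (color_class C2 d k')"
  shows "embeddable G c (C1 \<union> C2) d"
proof -
  interpret graph G by fact
  have ZV: "Z \<subseteq> verts G"
    using Z by (simp add: leaf_cover_def)
  define N where "N = verts G - Z"
  note counts = double_chain_counts(1)[OF dc compat finite_verts]
  note counts_Z = card_color_class_Diff[OF finite_verts ZV, of c, folded N_def]
  have "card (color_class C1 d k') \<le> card (color_class N c k')"
    using counts[of k'] counts_Z[of k'] card_Z by simp
  then obtain R1 where R1: "R1 \<subseteq> color_class N c k'" "card R1 = card (color_class C1 d k')"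
    by (rule obtain_subset_with_card_n)
  have "card (color_class C2 d k) \<le> card (color_class N c k)"
    using counts[of k] counts_Z[of k] card_Z by simp
  then obtain R2 where R2: "R2 \<subseteq> color_class N c k" "card R2 = card (color_class C2 d k)"
    by (rule obtain_subset_with_card_n)
  have R: "R1 \<union> R2 \<subseteq> N"
    using R1 R2 by (auto simp: color_class_def)
  have "color_class (R1 \<union> R2) c k' = R1" "color_class (R1 \<union> R2) c k = R2"
    using R1(1) R2(1) k by (auto simp: color_class_def)
  then have cards: "card (color_class (R1 \<union> R2) c k') = card (color_class C1 d k')"
    "card (color_class (R1 \<union> R2) c k) = card (color_class C2 d k)"
    using R1 R2 by simp_all
  show ?thesis
  proof (rule embeddable_double_chain[OF assms(1) dc proper compat layers _ _ _ k cards])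
    show "R1 \<union> R2 \<subseteq> verts G"
      using R by (auto simp: N_def)
    have not_Z: "u \<notin> Z" if "u \<in> R1 \<union> R2" for u
      using that R by (auto simp: N_def)
    show "v \<notin> R1 \<union> R2" if "u \<in> R1 \<union> R2" "u \<rightarrow>\<^bsub>G\<^esub> v" for u v
      using not_Z[OF that(1)] not_Z[of v] Z that(2) unfolding leaf_cover_def by metis
    show "v = w" if "u \<in> R1 \<union> R2" "u \<rightarrow>\<^bsub>G\<^esub> v" "u \<rightarrow>\<^bsub>G\<^esub> w" for u v w
      using not_Z[OF that(1)] Z that(2,3) unfolding leaf_cover_def by metis
  qed
qed

lemma balanced_color_counts:
  assumes bdc: "balanced_double_chain C1 C2" and equi: "equitable_coloring G c"
    and compat: "compatible_coloring G c (C1 \<union> C2) d" and fin: "finite (verts G)"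
  defines "b1 \<equiv> card (color_class C1 d Black)" and "w1 \<equiv> card (color_class C1 d White)"
    and "b2 \<equiv> card (color_class C2 d Black)" and "w2 \<equiv> card (color_class C2 d White)"
  shows "card (color_class (verts G) c Black) = b1 + b2" "card (color_class (verts G) c White) = w1 + w2"
    "card (verts G) = b1 + b2 + (w1 + w2)"
    "b1 + w1 \<le> b2 + w2 + 1" "b2 + w2 \<le> b1 + w1 + 1" "b1 + b2 \<le> w1 + w2 + 1" "w1 + w2 \<le> b1 + b2 + 1"
proof -
  have dc: "double_chain C1 C2"
    using bdc by (simp add: balanced_double_chain_def)
  note n = double_chain_counts(1)[OF dc compat fin]
  show bw: "card (color_class (verts G) c Black) = b1 + b2" "card (color_class (verts G) c White) = w1 + w2"
    using n[of Black] n[of White] by (simp_all add: assms)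
  show "card (verts G) = b1 + b2 + (w1 + w2)"
    using card_color_classes[OF fin, of Black White c] bw by simp
  show "b1 + b2 \<le> w1 + w2 + 1" "w1 + w2 \<le> b1 + b2 + 1"
    using equi unfolding equitable_coloring_def bw by linarith+
  have "card C1 = b1 + w1" "card C2 = b2 + w2"
    using card_color_classes[OF double_chain_counts(2)[OF dc compat fin], of Black White d]
      card_color_classes[OF double_chain_counts(3)[OF dc compat fin], of Black White d]
    by (simp_all add: assms)
  then show "b1 + w1 \<le> b2 + w2 + 1" "b2 + w2 \<le> b1 + w1 + 1"
    using bdc unfolding balanced_double_chain_def by linarith+
qed

lemma embeddable_if_balanced_leaf_cover:
  fixes G :: "('a, 'b) pre_digraph"
  assumes "graph G" and bdc: "balanced_double_chain C1 C2" and proper: "proper_coloring G c"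
    and equi: "equitable_coloring G c"
    and compat: "compatible_coloring G c (C1 \<union> C2) d" and layers: "two_layer G c r"
    and Z: "leaf_cover G Z" and card_Z: "2 * card Z \<le> card (verts G)"
    and bal: "\<bar>int (card (color_class Z c Black)) - int (card (color_class Z c White))\<bar> \<le> 1"
  shows "embeddable G c (C1 \<union> C2) d"
proof -
  interpret graph G by fact
  have dc: "double_chain C1 C2"
    using bdc by (simp add: balanced_double_chain_def)
  have "finite Z"
    using Z finite_verts by (auto simp: leaf_cover_def intro: finite_subset)
  then have "card Z = card (color_class Z c Black) + card (color_class Z c White)"
    by (intro card_color_classes) auto
  then have sum: "2 * card (color_class Z c Black) + 2 * card (color_class Z c White) \<le> card (verts G)"
    using card_Z by linarith
  have bal': "card (color_class Z c Black) \<le> card (color_class Z c White) + 1"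
    "card (color_class Z c White) \<le> card (color_class Z c Black) + 1"
    using bal by linarith+
  \<comment> \<open>If both alternatives fail, the two violated bounds concern one chain or one
    color, so the two numbers concerned add up to at least (n - 1)/2, where n is the number of
    points. On one chain, \<open>zb + zw\<close> exceeds their sum by 2. For one color, twice the
    larger class of \<open>Z\<close> exceeds it by 2, and balance leaves an excess of at least 1 for
    \<open>zb + zw\<close>. Either way \<open>zb + zw\<close> is more than n/2.\<close>
  have "zb \<le> b1 \<and> zw \<le> w2 \<or> zw \<le> w1 \<and> zb \<le> b2"
    if "zb \<le> zw + 1" "zw \<le> zb + 1" "2 * zb + 2 * zw \<le> b1 + b2 + (w1 + w2)"
      "b1 + w1 \<le> b2 + w2 + 1" "b2 + w2 \<le> b1 + w1 + 1" "b1 + b2 \<le> w1 + w2 + 1" "w1 + w2 \<le> b1 + b2 + 1"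
    for zb zw b1 b2 w1 w2 :: nat
  proof (rule ccontr)
    assume "\<not> ?thesis"
    then have "(b1 < zb \<or> w2 < zw) \<and> (w1 < zw \<or> b2 < zb)"
      by (simp add: not_le)
    then show False
      using that by (elim conjE disjE) linarith+
  qed
  note this[OF bal' sum[unfolded balanced_color_counts(3)[OF bdc equi compat finite_verts]]
      balanced_color_counts(4-7)[OF bdc equi compat finite_verts]]
  then show ?thesis
  proof (elim disjE conjE)
    show ?thesis if "card (color_class Z c Black) \<le> card (color_class C1 d Black)"
      "card (color_class Z c White) \<le> card (color_class C2 d White)"
      using embeddable_if_leaf_cover[OF assms(1) dc proper compat layers Z _ that] by simp
    show ?thesis if "card (color_class Z c White) \<le> card (color_class C1 d White)"
      "card (color_class Z c Black) \<le> card (color_class C2 d Black)"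
      using embeddable_if_leaf_cover[OF assms(1) dc proper compat layers Z _ that] by simp
  qed
qed

section \<open>Forests of stars\<close>

text \<open>One center for every star with an edge, and none for an isolated vertex. Every center
  thus comes with a leaf, which is what bounds the size of \<open>Z\<close>.\<close>

definition star_cover :: "('a, 'b) pre_digraph \<Rightarrow> 'a set \<Rightarrow> bool" where
  "star_cover G Z \<longleftrightarrow> Z \<subseteq> verts G \<and> (\<forall>u v. u \<rightarrow>\<^bsub>G\<^esub> v \<longrightarrow> (u \<in> Z \<longleftrightarrow> v \<notin> Z)) \<and>
     (\<forall>u v w. u \<notin> Z \<longrightarrow> u \<rightarrow>\<^bsub>G\<^esub> v \<longrightarrow> u \<rightarrow>\<^bsub>G\<^esub> w \<longrightarrow> v = w) \<and> (\<forall>z\<in>Z. \<exists>v. z \<rightarrow>\<^bsub>G\<^esub> v)"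

lemma star_coverD:
  assumes "star_cover G Z"
  shows "Z \<subseteq> verts G" "u \<rightarrow>\<^bsub>G\<^esub> v \<Longrightarrow> u \<in> Z \<longleftrightarrow> v \<notin> Z"
    "u \<notin> Z \<Longrightarrow> u \<rightarrow>\<^bsub>G\<^esub> v \<Longrightarrow> u \<rightarrow>\<^bsub>G\<^esub> w \<Longrightarrow> v = w" "z \<in> Z \<Longrightarrow> \<exists>v. z \<rightarrow>\<^bsub>G\<^esub> v"
  using assms unfolding star_cover_def by metis+

lemma star_cover_imp_leaf_cover: "star_cover G Z \<Longrightarrow> leaf_cover G Z"
  unfolding star_cover_def leaf_cover_def by metis

text \<open>Choosing one leaf per center is injective, because a leaf has a single neighbor.\<close>

lemma star_cover_card:
  assumes "graph G" "star_cover G Z"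
  shows "2 * card Z \<le> card (verts G)"
proof -
  interpret graph G by fact
  note Z = star_coverD[OF assms(2)]
  define leaf where "leaf z = (SOME v. z \<rightarrow>\<^bsub>G\<^esub> v)" for z
  have leaf: "z \<rightarrow>\<^bsub>G\<^esub> leaf z" if "z \<in> Z" for z
    using someI_ex[OF Z(4)[OF that]] by (simp add: leaf_def)
  have sub: "leaf ` Z \<subseteq> verts G - Z"
    using Z(2)[OF leaf] adj_in_verts(2)[OF leaf] by blast
  have "inj_on leaf Z"
  proof (rule inj_onI)
    fix x y assume *: "x \<in> Z" "y \<in> Z" "leaf x = leaf y"
    have "leaf x \<rightarrow>\<^bsub>G\<^esub> x" "leaf x \<rightarrow>\<^bsub>G\<^esub> y" "leaf x \<notin> Z"
      using graph_symmetric[OF leaf[OF *(1)]] graph_symmetric[OF leaf[OF *(2)]] Z(2)[OF leaf[OF *(1)]] *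
      by simp_all
    then show "x = y"
      by (intro Z(3))
  qed
  then have "card Z \<le> card (verts G - Z)"
    using card_mono[OF _ sub] by (simp add: card_image)
  also have "\<dots> = card (verts G) - card Z"
    using Z(1) finite_subset[OF Z(1)] by (intro card_Diff_subset) auto
  finally show ?thesis
    using card_mono[OF finite_verts Z(1)] by simp
qed

text \<open>The two leaves of each center of color \<open>k\<close> are shared with no other center
  and have color \<open>k'\<close>; they are also distinct from the centers of color
  \<open>k'\<close>. This is the bound available when no center of color \<open>k\<close> can be
  exchanged with its leaf.\<close>

lemma star_cover_degree_two_card:
  assumes "graph G" "star_cover G Z" "proper_coloring G c" "k \<noteq> k'"
    and two: "\<And>z. z \<in> color_class Z c k \<Longrightarrow> \<exists>v w. z \<rightarrow>\<^bsub>G\<^esub> v \<and> z \<rightarrow>\<^bsub>G\<^esub> w \<and> v \<noteq> w"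
  shows "2 * card (color_class Z c k) + card (color_class Z c k') \<le> card (color_class (verts G) c k')"
proof -
  interpret graph G by fact
  note Z = star_coverD[OF assms(2)]
  obtain f g where fg: "\<And>z. z \<in> color_class Z c k \<Longrightarrow> z \<rightarrow>\<^bsub>G\<^esub> f z \<and> z \<rightarrow>\<^bsub>G\<^esub> g z \<and> f z \<noteq> g z"
    using two by metis
  let ?K = "color_class Z c k"
  have fin: "finite ?K"
    using finite_subset[OF Z(1)] by (simp add: color_class_simps)
  have eq: "x = y" if "x \<in> ?K" "y \<in> ?K" "x \<rightarrow>\<^bsub>G\<^esub> w" "y \<rightarrow>\<^bsub>G\<^esub> w" for x y w
  proof -
    have "w \<rightarrow>\<^bsub>G\<^esub> x" "w \<rightarrow>\<^bsub>G\<^esub> y" "w \<notin> Z"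
      using graph_symmetric[OF that(3)] graph_symmetric[OF that(4)] Z(2)[OF that(3)] that(1)
      by (simp_all add: color_class_def)
    then show ?thesis
      by (intro Z(3))
  qed
  have "inj_on f ?K" "inj_on g ?K"
    by (rule inj_onI; metis eq fg)+
  moreover have "f ` ?K \<inter> g ` ?K = {}"
  proof -
    have "f x \<noteq> g y" if "x \<in> ?K" "y \<in> ?K" for x y
      using eq[OF that, of "f x"] fg[OF that(1)] fg[OF that(2)] by auto
    then show ?thesis
      by auto
  qed
  ultimately have "2 * card ?K = card (f ` ?K \<union> g ` ?K)"
    using fin by (simp add: card_Un_disjoint card_image)
  also have "\<dots> \<le> card (color_class (verts G - Z) c k')"
  proof (rule card_mono)
    have "w \<in> color_class (verts G - Z) c k'" if "z \<in> ?K" "z \<rightarrow>\<^bsub>G\<^esub> w" for z w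
    proof -
      have "c z \<noteq> c w" "w \<in> verts G" "w \<notin> Z" "c z = k"
        using that(1) assms(3) that(2) Z(2)[OF that(2)] adj_in_verts(2)[OF that(2)]
        by (auto simp: proper_coloring_def color_class_def)
      then show ?thesis
        using color_cases[OF assms(4), of "c w"] by (auto simp: color_class_def)
    qed
    then show "f ` ?K \<union> g ` ?K \<subseteq> color_class (verts G - Z) c k'"
      using fg by blast
  qed (simp add: color_class_simps)
  finally show ?thesis
    using card_color_class_Diff[OF finite_verts Z(1), of c k'] by simp
qed

text \<open>The leaf \<open>l\<close> has no neighbor besides \<open>z\<close>, so the edge is a
  component of its own.\<close>

lemma star_cover_flip:
  assumes "graph G" "star_cover G Z" "z \<in> Z" "z \<rightarrow>\<^bsub>G\<^esub> l" "\<And>w. z \<rightarrow>\<^bsub>G\<^esub> w \<Longrightarrow> w = l"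
  shows "star_cover G (insert l (Z - {z}))"
proof -
  interpret graph G by fact
  note Z = star_coverD[OF assms(2)]
  have l: "l \<notin> Z" "l \<rightarrow>\<^bsub>G\<^esub> z" "l \<in> verts G" "l \<noteq> z"
    using Z(2)[OF assms(4)] assms(3) graph_symmetric[OF assms(4)] adj_in_verts(2)[OF assms(4)] by auto
  have lz: "w = z" if "l \<rightarrow>\<^bsub>G\<^esub> w" for w
    using Z(3)[OF l(1,2) that] by simp
  have wl: "w = z" if "w \<rightarrow>\<^bsub>G\<^esub> l" for w
    using lz graph_symmetric that by blast
  have wz: "w = l" if "w \<rightarrow>\<^bsub>G\<^esub> z" for w
    using assms(5) graph_symmetric that by blast
  show ?thesis
    unfolding star_cover_def
  proof (intro conjI allI impI ballI)
    show "insert l (Z - {z}) \<subseteq> verts G"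
      using Z(1) l by auto
    show "u \<in> insert l (Z - {z}) \<longleftrightarrow> v \<notin> insert l (Z - {z})" if "u \<rightarrow>\<^bsub>G\<^esub> v" for u v
    proof (cases "u \<in> {l, z} \<or> v \<in> {l, z}")
      case True
      then have "u = l \<and> v = z \<or> u = z \<and> v = l"
        using that lz wl wz assms(5) by blast
      then show ?thesis
        using l by auto
    next
      case False
      then show ?thesis
        using Z(2)[OF that] by auto
    qed
    show "v = w" if "u \<notin> insert l (Z - {z})" "u \<rightarrow>\<^bsub>G\<^esub> v" "u \<rightarrow>\<^bsub>G\<^esub> w" for u v w
    proof (cases "u = z")
      case True
      then show ?thesis
        using that assms(5) by blast
    next
      case False
      then show ?thesis
        using that Z(3) by blast
    qed
    show "\<exists>v. w \<rightarrow>\<^bsub>G\<^esub> v" if "w \<in> insert l (Z - {z})" for w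
      using that l Z(4) by blast
  qed
qed

text \<open>
  A single edge may have either endpoint as its center. Flipping such edges moves one unit
  from an overfull color to the other one.
\<close>

lemma ex_star_cover_le:
  fixes G :: "('a, 'b) pre_digraph" and U :: "color \<Rightarrow> nat"
  assumes "graph G" "star_cover G Z0" "proper_coloring G c"
    and U: "\<And>k k'. k \<noteq> k' \<Longrightarrow> card (color_class (verts G) c k') \<le> 2 * U k + 1"
    and U_sum: "card (verts G) \<le> 2 * (U Black + U White) + 1"
  shows "\<exists>Z. star_cover G Z \<and> (\<forall>k. card (color_class Z c k) \<le> U k)"
proof -
  interpret graph G by fact
  \<comment> \<open>The total excess over the bounds \<open>U\<close>; truncated subtraction lets a
    color below its bound contribute 0. A star cover minimizing it turns out to have excess
    0.\<close>
  let ?ex = "\<lambda>Z. (card (color_class Z c Black) - U Black) + (card (color_class Z c White) - U White)"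
  obtain Z where Z: "star_cover G Z" and least: "\<And>Z'. star_cover G Z' \<Longrightarrow> ?ex Z \<le> ?ex Z'"
    using ex_has_least_nat[of "star_cover G" Z0 ?ex] assms(2) by blast
  note D = star_coverD[OF Z]
  have finZ: "finite Z"
    using finite_subset[OF D(1)] by simp
  have False if kk: "k \<noteq> k'" and gt: "U k < card (color_class Z c k)" for k k'
  proof -
    have sum: "card (color_class Z c k) + card (color_class Z c k') = card Z"
      using card_color_classes[OF finZ kk] by simp
    have U_eq: "U Black + U White = U k + U k'"
      using kk by (cases k; cases k') auto
    \<comment> \<open>\<open>2 * card Z \<le> card (verts G)\<close> and \<open>U_sum\<close> give
      \<open>card Z \<le> U k + U k'\<close>, so an excess in color \<open>k\<close> leaves room for
      at least one more center of color \<open>k'\<close>.\<close>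
    have less: "card (color_class Z c k') < U k'"
      using star_cover_card[OF assms(1) Z] sum U_sum gt unfolding U_eq distrib_left by linarith
    \<comment> \<open>The right-hand side is at most \<open>2 * U k + 1\<close>, which is below
      \<open>2 * card (color_class Z c k)\<close>. Hence some center of color \<open>k\<close> has a
      single leaf and can be flipped.\<close>
    have "\<not> (2 * card (color_class Z c k) + card (color_class Z c k') \<le> card (color_class (verts G) c k'))"
      using U[OF kk] gt by linarith
    then have "\<not> (\<forall>z\<in>color_class Z c k. \<exists>v w. z \<rightarrow>\<^bsub>G\<^esub> v \<and> z \<rightarrow>\<^bsub>G\<^esub> w \<and> v \<noteq> w)"
      by (rule contrapos_nn) (rule star_cover_degree_two_card[OF assms(1) Z assms(3) kk], rule bspec)
    then obtain z where z: "z \<in> color_class Z c k" "\<And>v w. z \<rightarrow>\<^bsub>G\<^esub> v \<Longrightarrow> z \<rightarrow>\<^bsub>G\<^esub> w \<Longrightarrow> v = w"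
      by auto
    then have zZ: "z \<in> Z" "c z = k"
      by (auto simp: color_class_def)
    then obtain l where l: "z \<rightarrow>\<^bsub>G\<^esub> l"
      using D(4) by blast
    define Z' where "Z' = insert l (Z - {z})"
    have Z': "star_cover G Z'"
      unfolding Z'_def using star_cover_flip[OF assms(1) Z zZ(1) l] z(2) l by blast
    have "c z \<noteq> c l"
      using assms(3) l unfolding proper_coloring_def by blast
    then have lc: "l \<notin> Z" "c l = k'"
      using D(2)[OF l] zZ color_cases[OF kk, of "c l"] by auto
    have "color_class Z' c k = color_class Z c k - {z}" "color_class Z' c k' = insert l (color_class Z c k')"
      using lc zZ kk by (auto simp: Z'_def color_class_def)
    then have "card (color_class Z' c k) = card (color_class Z c k) - 1"
      "card (color_class Z' c k') = card (color_class Z c k') + 1"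
      using z(1) lc finZ by (simp_all add: color_class_simps)
    then have "?ex Z' < ?ex Z"
      using gt less kk by (cases k; cases k') auto
    then show False
      using least[OF Z'] by simp
  qed
  then have "card (color_class Z c k) \<le> U k" for k
    by (cases k) (metis color.distinct linorder_not_less)+
  then show ?thesis
    using Z by blast
qed

section \<open>Two-layer drawings of star forests by lexicographic positions\<close>

lemma lex_less_iff:
  fixes N i j a b :: nat
  assumes "a < N" "b < N"
  shows "N * i + a < N * j + b \<longleftrightarrow> i < j \<or> i = j \<and> a < b"
proof (cases "i = j")
  case False
  have *: "N * i + a < N * j" if "i < j" "a < N" for i j a :: nat
  proof -
    have "N * Suc i \<le> N * j"
      using that by (intro mult_le_mono) auto
    then show ?thesis
      using that by simp
  qed
  from False consider "i < j" | "j < i"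
    by linarith
  then show ?thesis
    by cases (use *[of i j a] *[of j i b] assms in auto)
qed simp

lemma lex_eq_iff:
  fixes N i j a b :: nat
  assumes "a < N" "b < N"
  shows "N * i + a = N * j + b \<longleftrightarrow> i = j \<and> a = b"
  using lex_less_iff[OF assms, of i j] lex_less_iff[OF assms(2,1), of j i] by auto

text \<open>Sorting by the center first makes every star a block, so edges of different stars keep
  their order. Two edges of one star that start at different vertices of equal color both start at
  leaves and end at the common center.\<close>

lemma star_cover_two_layer:
  assumes "graph G" "star_cover G Z" "proper_coloring G c"
  shows "\<exists>r. two_layer G c r"
proof -
  interpret graph G by fact
  note Z = star_coverD[OF assms(2)]
  obtain g where g: "bij_betw g (verts G) {0..<card (verts G)}"
    using ex_bij_betw_finite_nat[OF finite_verts] by blast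
  define n where "n = card (verts G)"
  have gn: "g v < n" if "v \<in> verts G" for v
    using g that by (auto simp: bij_betw_def n_def)
  have g_eq: "g u = g v \<longleftrightarrow> u = v" if "u \<in> verts G" "v \<in> verts G" for u v
    using g that by (auto simp: bij_betw_def dest: inj_onD)
  \<comment> \<open>The center of the star containing \<open>v\<close>; an isolated vertex counts as
    its own center.\<close>
  define z where "z v = (if v \<notin> Z \<and> (\<exists>w. v \<rightarrow>\<^bsub>G\<^esub> w) then SOME w. v \<rightarrow>\<^bsub>G\<^esub> w else v)" for v
  have z_leaf: "z v = w" if "v \<rightarrow>\<^bsub>G\<^esub> w" "v \<notin> Z" for v w
  proof -
    have "v \<rightarrow>\<^bsub>G\<^esub> (SOME w. v \<rightarrow>\<^bsub>G\<^esub> w)"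
      using that by (rule_tac someI)
    then show ?thesis
      using that Z(3) unfolding z_def by auto
  qed
  have z_center: "z v = v" if "v \<in> Z" for v
    using that by (simp add: z_def)
  have z_edge: "z u = z v \<and> (u = z u \<or> v = z u) \<and> z u \<in> verts G" if "u \<rightarrow>\<^bsub>G\<^esub> v" for u v
  proof (cases "u \<in> Z")
    case True
    then have "v \<notin> Z"
      using Z(2)[OF that] by simp
    then show ?thesis
      using z_leaf[OF graph_symmetric[OF that]] z_center[OF True] adj_in_verts(1)[OF that] by simp
  next
    case False
    then have "v \<in> Z"
      using Z(2)[OF that] by simp
    then show ?thesis
      using z_leaf[OF that False] z_center adj_in_verts(2)[OF that] by simp
  qed
  define r where "r v = real (n * g (z v) + g v)" for v
  have "inj_on r (color_class (verts G) c k)" for k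
  proof (rule inj_onI)
    fix u v assume *: "u \<in> color_class (verts G) c k" "v \<in> color_class (verts G) c k" "r u = r v"
    then have V: "u \<in> verts G" "v \<in> verts G"
      by (simp_all add: color_class_def)
    have "n * g (z u) + g u = n * g (z v) + g v"
      using *(3) unfolding r_def by (simp only: of_nat_eq_iff)
    then show "u = v"
      using lex_eq_iff[OF gn[OF V(1)] gn[OF V(2)]] g_eq[OF V] by simp
  qed
  moreover have "r v \<le> r y"
    if e: "u \<rightarrow>\<^bsub>G\<^esub> v" "x \<rightarrow>\<^bsub>G\<^esub> y" "c u = c x" "r u < r x" for u v x y
  proof -
    have V: "u \<in> verts G" "v \<in> verts G" "x \<in> verts G" "y \<in> verts G"
      using e adj_in_verts by auto
    have lt: "g (z u) < g (z x) \<or> g (z u) = g (z x) \<and> g u < g x"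
      using e(4) lex_less_iff[OF gn[OF V(1)] gn[OF V(3)]] unfolding r_def of_nat_less_iff by simp
    show ?thesis
    proof (cases "z u = z x")
      case True
      have "x \<noteq> v" "u \<noteq> y" "u \<noteq> x"
        using proper_coloringD[OF assms(3) e(1)] proper_coloringD[OF assms(3) e(2)] e(3,4) by auto
      then have "v = y"
        using z_edge[OF e(1)] z_edge[OF e(2)] True by metis
      then show ?thesis
        by simp
    next
      case False
      then have "g (z v) < g (z y)"
        using lt z_edge[OF e(1)] z_edge[OF e(2)] g_eq[of "z u" "z x"] by auto
      then have "n * g (z v) + g v < n * g (z y) + g y"
        using lex_less_iff[OF gn[OF V(2)] gn[OF V(4)]] by simp
      then show ?thesis
        unfolding r_def by (simp only: of_nat_le_iff less_imp_le)
    qed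
  qed
  ultimately show ?thesis
    unfolding two_layer_def by blast
qed

section \<open>Embedding forests of stars\<close>

lemma forest_of_stars_star_cover:
  fixes G :: "('a, 'b) pre_digraph"
  assumes "forest_of_stars G"
  shows "\<exists>Z. star_cover G Z"
proof -
  interpret graph G
    using assms by (simp add: forest_of_stars_def)
  define S where "S v = G \<restriction> scc_of v" for v
  have "S v \<in> sccs" if "v \<in> verts G" for v
    using scc_of_in_sccs_verts[OF that] in_verts_sccsD_sccs by (simp add: S_def)
  then have "star (S v)" if "v \<in> verts G" for v
    using that assms by (simp add: forest_of_stars_def)
  then have ex: "\<exists>z. \<forall>u\<in>scc_of v. \<forall>w\<in>scc_of v. u \<rightarrow>\<^bsub>S v\<^esub> w \<longrightarrow> u \<noteq> w \<and> (u = z \<or> w = z)"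
    if "v \<in> verts G" for v
    using that unfolding star_def S_def by fastforce
  \<comment> \<open>The choice depends on the component \<open>T\<close> alone, so that all its
    vertices agree on the center, also when a single edge admits two.\<close>
  define ctr where "ctr T = (SOME z. \<forall>u\<in>T. \<forall>w\<in>T. u \<rightarrow>\<^bsub>G \<restriction> T\<^esub> w \<longrightarrow> u \<noteq> w \<and> (u = z \<or> w = z))" for T
  have ctr: "u \<noteq> w \<and> (u = ctr (scc_of v) \<or> w = ctr (scc_of v))"
    if "v \<in> verts G" "u \<in> scc_of v" "w \<in> scc_of v" "u \<rightarrow>\<^bsub>S v\<^esub> w" for v u w
    using someI_ex[OF ex[OF that(1)]] that(2-4) unfolding ctr_def S_def by blast
  define z where "z v = ctr (scc_of v)" for v
  have edge: "u \<noteq> v \<and> z u = z v \<and> (u = z u \<or> v = z u)" if "u \<rightarrow>\<^bsub>G\<^esub> v" for u v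
  proof -
    have "u \<in> verts G" "v \<in> verts G"
      using that adj_in_verts by auto
    have "v \<in> scc_of u"
      using that by (intro scc_ofI_reachable') simp
    then have eq: "scc_of v = scc_of u"
      by (rule scc_of_eq)
    have "u \<in> scc_of u"
      using in_scc_of_self[OF \<open>u \<in> verts G\<close>] .
    moreover have "u \<rightarrow>\<^bsub>S u\<^esub> v"
      using that calculation \<open>v \<in> scc_of u\<close> by (auto simp: S_def arcs_ends_conv)
    ultimately show ?thesis
      using ctr[of u u v] \<open>u \<in> verts G\<close> \<open>v \<in> scc_of u\<close> eq by (simp add: z_def)
  qed
  have "star_cover G {v \<in> verts G. z v = v \<and> (\<exists>w. v \<rightarrow>\<^bsub>G\<^esub> w)}"
    unfolding star_cover_def
  proof (intro conjI allI impI ballI)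
    show "u \<in> {v \<in> verts G. z v = v \<and> (\<exists>w. v \<rightarrow>\<^bsub>G\<^esub> w)} \<longleftrightarrow>
      v \<notin> {v \<in> verts G. z v = v \<and> (\<exists>w. v \<rightarrow>\<^bsub>G\<^esub> w)}" if "u \<rightarrow>\<^bsub>G\<^esub> v" for u v
      using edge[OF that] that graph_symmetric[OF that] adj_in_verts[OF that] by auto
    show "v = w" if "u \<notin> {v \<in> verts G. z v = v \<and> (\<exists>w. v \<rightarrow>\<^bsub>G\<^esub> w)}" "u \<rightarrow>\<^bsub>G\<^esub> v" "u \<rightarrow>\<^bsub>G\<^esub> w" for u v w
      using edge[OF that(2)] edge[OF that(3)] that adj_in_verts[OF that(2)] by auto
  qed auto
  then show ?thesis
    by blast
qed

lemma embeddable_forest_of_stars: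
  fixes G :: "('a, 'b) pre_digraph"
  assumes "graph G" and stars: "forest_of_stars G" and bdc: "balanced_double_chain C1 C2"
    and proper: "proper_coloring G c" and equi: "equitable_coloring G c"
    and compat: "compatible_coloring G c (C1 \<union> C2) d"
  shows "embeddable G c (C1 \<union> C2) d"
proof -
  interpret graph G by fact
  obtain Z0 where Z0: "star_cover G Z0"
    using forest_of_stars_star_cover[OF stars] by blast
  obtain r where r: "two_layer G c r"
    using star_cover_two_layer[OF assms(1) Z0 proper] by blast
  have dc: "double_chain C1 C2"
    using bdc by (simp add: balanced_double_chain_def)
  have ?thesis if kk: "k \<noteq> k'"
    and U1: "card (color_class (verts G) c k') \<le> 2 * card (color_class C1 d k) + 1"
    and U2: "card (color_class (verts G) c k) \<le> 2 * card (color_class C2 d k') + 1"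
    and U12: "card (verts G) \<le> 2 * (card (color_class C1 d k) + card (color_class C2 d k')) + 1" for k k'
  proof -
    \<comment> \<open>The capacities demanded by \<open>embeddable_if_leaf_cover\<close>: color
      \<open>k\<close> counts its points on \<open>C1\<close>, color \<open>k'\<close> those on
      \<open>C2\<close>.\<close>
    define U where "U j = (if j = k then card (color_class C1 d k) else card (color_class C2 d k'))" for j
    have U_sum: "U Black + U White = card (color_class C1 d k) + card (color_class C2 d k')"
      using kk by (cases k; cases k') (auto simp: U_def)
    have "card (color_class (verts G) c j') \<le> 2 * U j + 1" if "j \<noteq> j'" for j j'
      using that kk U1 U2 color_cases[OF kk, of j] color_cases[OF kk, of j'] by (auto simp: U_def)
    then obtain Z where Z: "star_cover G Z" "\<And>j. card (color_class Z c j) \<le> U j"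
      using ex_star_cover_le[OF assms(1) Z0 proper, of U] U_sum U12 by auto
    show ?thesis
      using Z(2)[of k] Z(2)[of k'] kk
      by (intro embeddable_if_leaf_cover[OF assms(1) dc proper compat r star_cover_imp_leaf_cover[OF Z(1)] kk])
        (auto simp: U_def)
  qed
  note * = this[of Black White] this[of White Black]
  \<comment> \<open>Adding the balance conditions in pairs shows that \<open>b1\<close> and
    \<open>w2\<close> differ by at most 1, and so do \<open>w1\<close> and \<open>b2\<close>. The
    designation with the larger sum then satisfies all the bounds that
    \<open>ex_star_cover_le\<close> asks for.\<close>
  have "w1 + w2 \<le> 2 * b1 + 1 \<and> b1 + b2 \<le> 2 * w2 + 1 \<and> b1 + b2 + (w1 + w2) \<le> 2 * (b1 + w2) + 1 \<or>
      b1 + b2 \<le> 2 * w1 + 1 \<and> w1 + w2 \<le> 2 * b2 + 1 \<and> b1 + b2 + (w1 + w2) \<le> 2 * (w1 + b2) + 1"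
    if "b1 + w1 \<le> b2 + w2 + 1" "b2 + w2 \<le> b1 + w1 + 1" "b1 + b2 \<le> w1 + w2 + 1" "w1 + w2 \<le> b1 + b2 + 1"
    for b1 b2 w1 w2 :: nat
  proof (cases "w1 + b2 \<le> b1 + w2")
    case True
    then show ?thesis
      unfolding distrib_left using that by (intro disjI1 conjI) linarith+
  next
    case False
    then show ?thesis
      unfolding distrib_left using that by (intro disjI2 conjI) linarith+
  qed
  note this[OF balanced_color_counts(4-7)[OF bdc equi compat finite_verts]]
  then show ?thesis
    using * balanced_color_counts(1-3)[OF bdc equi compat finite_verts] by auto
qed

section \<open>Caterpillars\<close>

lemma out_degree_eq_card_neighbors:
  assumes "graph G"
  shows "out_degree G v = card {w. v \<rightarrow>\<^bsub>G\<^esub> w}"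
proof -
  interpret graph G by fact
  have "inj_on (head G) (out_arcs G v)"
    by (rule inj_onI) (auto intro!: no_multi_arcs simp: arc_to_ends_def)
  moreover have "head G ` out_arcs G v = {w. v \<rightarrow>\<^bsub>G\<^esub> w}"
    by (force simp: arcs_ends_conv)
  ultimately show ?thesis
    unfolding out_degree_def by (metis card_image)
qed

lemma leaves_iff:
  assumes "graph G"
  shows "v \<in> leaves G \<longleftrightarrow> (\<exists>w. v \<rightarrow>\<^bsub>G\<^esub> w \<and> (\<forall>x. v \<rightarrow>\<^bsub>G\<^esub> x \<longrightarrow> x = w))"
proof -
  interpret graph G by fact
  have "out_degree G v = 1 \<longleftrightarrow> (\<exists>w. {w. v \<rightarrow>\<^bsub>G\<^esub> w} = {w})"
    unfolding out_degree_eq_card_neighbors[OF assms] by (simp add: card_1_singleton_iff)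
  also have "\<dots> \<longleftrightarrow> (\<exists>w. v \<rightarrow>\<^bsub>G\<^esub> w \<and> (\<forall>x. v \<rightarrow>\<^bsub>G\<^esub> x \<longrightarrow> x = w))"
    by auto
  finally show ?thesis
    unfolding leaves_def using adj_in_verts(1)[of v] by auto
qed

lemma connected_closed_set:
  assumes "graph G" "Digraph_Component.connected G" "u \<in> verts G" "u \<in> S"
    and closed: "\<And>x y. x \<in> S \<Longrightarrow> x \<rightarrow>\<^bsub>G\<^esub> y \<Longrightarrow> y \<in> S"
  shows "verts G \<subseteq> S"
proof
  fix v assume v: "v \<in> verts G"
  interpret graph G by fact
  have "strongly_connected G"
    using symmetric_connected_imp_strongly_connected[OF sym_arcs assms(2)] .
  then have "u \<rightarrow>\<^sup>*\<^bsub>G\<^esub> v"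
    using assms(3) v by (simp add: strongly_connected_def)
  then show "v \<in> S"
    by (induction rule: reachable_induct) (use assms(4) closed in simp_all)
qed

lemma connected_nonempty: "Digraph_Component.connected G \<Longrightarrow> verts G \<noteq> {}"
  by (simp add: connected_conv)

lemma connected_proper_colorings:
  assumes "graph G" "Digraph_Component.connected G" "proper_coloring G c" "proper_coloring G c'"
  shows "(\<forall>v\<in>verts G. c v = c' v) \<or> (\<forall>v\<in>verts G. c v \<noteq> c' v)"
proof -
  obtain u where u: "u \<in> verts G"
    using connected_nonempty[OF assms(2)] by blast
  have "verts G \<subseteq> {v. (c v = c' v) = (c u = c' u)}"
  proof (rule connected_closed_set[OF assms(1,2) u])
    fix x y assume "x \<in> {v. (c v = c' v) = (c u = c' u)}" "x \<rightarrow>\<^bsub>G\<^esub> y"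
    then show "y \<in> {v. (c v = c' v) = (c u = c' u)}"
      using proper_coloringD[OF assms(3), of x y] proper_coloringD[OF assms(4), of x y]
      by (cases "c x"; cases "c y"; cases "c' x"; cases "c' y") simp_all
  qed simp
  then show ?thesis
    by (cases "c u = c' u") auto
qed

text \<open>Universality ranges over all proper colorings, whereas \<open>equitable_graph\<close>
  provides one equitable coloring. On a connected graph any other proper coloring is the same or its
  color swap, and swapping keeps the sizes balanced.\<close>

lemma connected_equitable_coloring:
  assumes "equitable_graph G" "Digraph_Component.connected G" "proper_coloring G c"
  shows "equitable_coloring G c"
proof -
  obtain c' where c': "graph G" "proper_coloring G c'" "equitable_coloring G c'"
    using assms(1) by (auto simp: equitable_graph_def)
  consider "\<forall>v\<in>verts G. c v = c' v" | "\<forall>v\<in>verts G. c v \<noteq> c' v"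
    using connected_proper_colorings[OF c'(1) assms(2,3) c'(2)] by blast
  then show ?thesis
  proof cases
    case 1
    then have "color_class (verts G) c k = color_class (verts G) c' k" for k
      by (auto simp: color_class_def)
    then show ?thesis
      using c'(3) by (simp add: equitable_coloring_def)
  next
    case 2
    have "c v = Black \<longleftrightarrow> c' v = White" "c v = White \<longleftrightarrow> c' v = Black" if "v \<in> verts G" for v
      using bspec[OF 2 that] by (cases "c v"; cases "c' v"; simp)+
    then have eq: "color_class (verts G) c Black = color_class (verts G) c' White"
      "color_class (verts G) c White = color_class (verts G) c' Black"
      by (auto simp: color_class_def)
    then show ?thesis
      using c'(3) unfolding equitable_coloring_def eq by linarith
  qed
qed

section \<open>Alternating colors along the spine and two-layer drawings of caterpillars\<close>

lemma alternating_color_counts: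
  assumes "distinct vs" "\<And>i. Suc i < length vs \<Longrightarrow> c (vs ! i) \<noteq> c (vs ! Suc i)"
  shows "\<bar>int (card (color_class (set vs) c Black)) - int (card (color_class (set vs) c White))\<bar> \<le> 1"
  using assms
proof (induction vs rule: induct_list012)
  case 1
  then show ?case
    by (simp add: color_class_def)
next
  case (2 x)
  have "color_class (set [x]) c k = (if c x = k then {x} else {})" for k
    by (auto simp: color_class_def)
  then show ?case
    by simp
next
  case (3 x y zs)
  have "\<bar>int (card (color_class (set zs) c Black)) - int (card (color_class (set zs) c White))\<bar> \<le> 1"
  proof (rule 3(1))
    show "c (zs ! i) \<noteq> c (zs ! Suc i)" if "Suc i < length zs" for i
      using 3(4)[of "Suc (Suc i)"] that by simp
  qed (use 3(3) in simp)
  moreover have "card (color_class (set (x # y # zs)) c k) = Suc (card (color_class (set zs) c k))" for k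
  proof -
    have "c x \<noteq> c y"
      using 3(4)[of 0] by simp
    define z where "z = (if c x = k then x else y)"
    have z: "z \<in> {x, y}" "color_class {x, y} c k = {z}"
      using color_cases[OF \<open>c x \<noteq> c y\<close>, of k] \<open>c x \<noteq> c y\<close> by (auto simp: z_def color_class_def)
    have "color_class (set (x # y # zs)) c k = insert z (color_class (set zs) c k)"
      using z(2) by (auto simp: color_class_def)
    moreover have "z \<notin> color_class (set zs) c k"
      using z(1) 3(3) by (auto simp: color_class_def)
    ultimately show ?thesis
      by (simp add: color_class_simps)
  qed
  ultimately show ?case
    by simp
qed

lemma alternating_color_parity:
  fixes c :: "'a \<Rightarrow> color"
  assumes "\<And>i. Suc i < length vs \<Longrightarrow> c (vs ! i) \<noteq> c (vs ! Suc i)" "i < length vs"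
  shows "(c (vs ! i) = c (vs ! 0)) \<longleftrightarrow> even i"
  using assms(2)
proof (induction i)
  case (Suc i)
  then have "(c (vs ! i) = c (vs ! 0)) \<longleftrightarrow> even i" "c (vs ! i) \<noteq> c (vs ! Suc i)"
    using assms(1)[of i] by simp_all
  then show ?case
    by (cases "c (vs ! i)"; cases "c (vs ! Suc i)"; cases "c (vs ! 0)") simp_all
qed simp

lemma caterpillar_spine:
  assumes "caterpillar G"
  obtains vs where "distinct vs" "set vs = non_leaves G"
    "\<And>i j. i < length vs \<Longrightarrow> j < length vs \<Longrightarrow> vs ! i \<rightarrow>\<^bsub>G\<^esub> vs ! j \<longleftrightarrow> j = Suc i \<or> i = Suc j"
proof -
  obtain vs where vs: "distinct vs" "set vs = non_leaves G"
    "\<forall>i < length vs. \<forall>j < length vs. vs ! i \<rightarrow>\<^bsub>G \<restriction> non_leaves G\<^esub> vs ! j \<longleftrightarrow> j = Suc i \<or> i = Suc j"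
    using assms by (auto simp: caterpillar_def path_graph_def)
  have "u \<rightarrow>\<^bsub>G \<restriction> non_leaves G\<^esub> v \<longleftrightarrow> u \<rightarrow>\<^bsub>G\<^esub> v" if "u \<in> non_leaves G" "v \<in> non_leaves G" for u v
    using that by (auto simp: arcs_ends_conv image_iff)
  then have "vs ! i \<rightarrow>\<^bsub>G\<^esub> vs ! j \<longleftrightarrow> j = Suc i \<or> i = Suc j" if "i < length vs" "j < length vs" for i j
    using vs(2,3) that nth_mem by metis
  then show thesis
    using that vs(1,2) by blast
qed

text \<open>Two adjacent leaves form a component by themselves, which leaves no vertex to be a
  non-leaf.\<close>

lemma leaf_neighbor_not_leaf:
  assumes "graph G" "Digraph_Component.connected G" "non_leaves G \<noteq> {}" "u \<rightarrow>\<^bsub>G\<^esub> v" "u \<in> leaves G"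
  shows "v \<in> non_leaves G"
proof (rule ccontr)
  assume v: "v \<notin> non_leaves G"
  interpret graph G by fact
  have "u \<in> verts G" "v \<in> verts G" "v \<rightarrow>\<^bsub>G\<^esub> u"
    using adj_in_verts[OF assms(4)] graph_symmetric[OF assms(4)] by auto
  then have "v \<in> leaves G"
    using v by (simp add: non_leaves_def)
  then have "verts G \<subseteq> {u, v}"
    using assms(5) leaves_iff[OF assms(1)] assms(4) \<open>v \<rightarrow>\<^bsub>G\<^esub> u\<close>
    by (intro connected_closed_set[OF assms(1,2) \<open>u \<in> verts G\<close>]) (simp, metis insertCI insertE singletonD)
  then have "verts G \<subseteq> leaves G"
    using assms(5) \<open>v \<in> leaves G\<close> by auto
  then show False
    using assms(3) by (simp add: non_leaves_def)
qed

text \<open>The spine indices of two edges \<open>u v\<close> and \<open>x y\<close> are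
  \<open>a\<close>, \<open>b\<close> and \<open>a'\<close>, \<open>b'\<close>; a Boolean
  \<open>p\<close> marks a spine vertex and \<open>o\<close> is the offset behind it. An edge
  changes the index by at most 1, and by parity the indices of \<open>u\<close> and
  \<open>x\<close>, if both are spine vertices or both are leaves, agree or differ by at least 2. A
  tie \<open>b = b'\<close> occurs only when \<open>v\<close> and \<open>y\<close> are spine
  vertices, whose offset is 0.\<close>

lemma caterpillar_order:
  fixes a b a' b' ou ov ox oy :: nat
  assumes "pu \<and> pv \<and> (b = Suc a \<or> a = Suc b) \<or> pu \<noteq> pv \<and> a = b"
    and "px \<and> py \<and> (b' = Suc a' \<or> a' = Suc b') \<or> px \<noteq> py \<and> a' = b'"
    and parity: "(even a = even a') = (pu = px)"
    and "a < a' \<or> a = a' \<and> ou < ox"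
    and "ou = 0 \<longleftrightarrow> pu" "ov = 0 \<longleftrightarrow> pv" "ox = 0 \<longleftrightarrow> px" "oy = 0 \<longleftrightarrow> py"
  shows "b < b' \<or> b = b' \<and> ov \<le> oy"
proof -
  have *: "Suc a < a'" if "a < a'" "pu = px"
    using that parity by (cases "a' = Suc a") auto
  have "a \<noteq> a'" if "pu \<noteq> px"
    using that parity by auto
  with * assms show ?thesis
    by (cases pu; cases pv; cases px; cases py) auto
qed

text \<open>
  The \<open>i\<close>-th spine vertex goes to position \<open>i * n\<close>, the leaves attached to it into the gap
  right after that position.
\<close>

lemma caterpillar_two_layer:
  assumes "graph G" "caterpillar G" "non_leaves G \<noteq> {}" "proper_coloring G c"
  shows "\<exists>r. two_layer G c r"
proof -
  interpret graph G by fact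
  have conn: "Digraph_Component.connected G"
    using assms(2) by (simp add: caterpillar_def undirected_tree_def)
  obtain vs where vs: "distinct vs" "set vs = non_leaves G"
    and vs_adj: "\<And>i j. i < length vs \<Longrightarrow> j < length vs \<Longrightarrow> vs ! i \<rightarrow>\<^bsub>G\<^esub> vs ! j \<longleftrightarrow> j = Suc i \<or> i = Suc j"
    using caterpillar_spine[OF assms(2)] by metis
  have alt: "c (vs ! i) \<noteq> c (vs ! Suc i)" if "Suc i < length vs" for i
    using vs_adj[of i "Suc i"] that proper_coloringD[OF assms(4)] by auto
  \<comment> \<open>Offset 0 is reserved for the spine and leaves have offset
    \<open>Suc (h v)\<close>, up to \<open>card (verts G)\<close>; hence the successor.\<close>
  define n where "n = Suc (card (verts G))"
  obtain h where h: "bij_betw h (verts G) {0..<card (verts G)}"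
    using ex_bij_betw_finite_nat[OF finite_verts] by blast
  define spine where "spine v = (if v \<in> non_leaves G then v else SOME w. v \<rightarrow>\<^bsub>G\<^esub> w)" for v
  define ix where "ix v = (THE i. i < length vs \<and> vs ! i = spine v)" for v
  define off where "off v = (if v \<in> non_leaves G then 0 else Suc (h v))" for v
  define r where "r v = real (n * ix v + off v)" for v
  have spine_leaf: "spine v = w \<and> w \<in> non_leaves G" if "v \<rightarrow>\<^bsub>G\<^esub> w" "v \<notin> non_leaves G" for v w
  proof -
    have l: "v \<in> leaves G"
      using that adj_in_verts by (auto simp: non_leaves_def)
    then have "(SOME w. v \<rightarrow>\<^bsub>G\<^esub> w) = w"
      using that(1) leaves_iff[OF assms(1), of v] by (intro some_equality) auto
    then show ?thesis
      using that(2) leaf_neighbor_not_leaf[OF assms(1) conn assms(3) that(1) l] by (simp add: spine_def)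
  qed
  have spine_in: "spine v \<in> non_leaves G" if "v \<in> verts G" for v
  proof (cases "v \<in> non_leaves G")
    case False
    then have "v \<in> leaves G"
      using that by (simp add: non_leaves_def)
    then obtain w where "v \<rightarrow>\<^bsub>G\<^esub> w"
      using leaves_iff[OF assms(1)] by blast
    then show ?thesis
      using spine_leaf False by blast
  qed (simp add: spine_def)
  have ix: "ix v < length vs \<and> vs ! ix v = spine v" if v: "v \<in> verts G" for v
  proof -
    obtain i where i: "i < length vs" "vs ! i = spine v"
      using spine_in[OF v] unfolding vs(2)[symmetric] by (auto simp: in_set_conv_nth)
    show ?thesis
      unfolding ix_def
    proof (rule theI[of _ i])
      show "j = i" if "j < length vs \<and> vs ! j = spine v" for j
        using nth_eq_iff_index_eq[OF vs(1), of j i] that i by simp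
    qed (use i in simp)
  qed
  have off: "off v < n" if "v \<in> verts G" for v
    using h that by (auto simp: off_def n_def bij_betw_def)
  have "inj_on r (color_class (verts G) c k)" for k
  proof (rule inj_onI)
    fix u v assume *: "u \<in> color_class (verts G) c k" "v \<in> color_class (verts G) c k" "r u = r v"
    then have V: "u \<in> verts G" "v \<in> verts G"
      by (simp_all add: color_class_def)
    have "n * ix u + off u = n * ix v + off v"
      using *(3) unfolding r_def by (simp only: of_nat_eq_iff)
    then have eq: "ix u = ix v" "off u = off v"
      using lex_eq_iff[OF off[OF V(1)] off[OF V(2)]] by auto
    show "u = v"
    proof (cases "u \<in> non_leaves G")
      case True
      then have "v \<in> non_leaves G"
        using eq(2) by (simp add: off_def split: if_splits)
      moreover have "spine u = spine v"
        using ix[OF V(1)] ix[OF V(2)] eq(1) by metis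
      ultimately show ?thesis
        using True by (simp add: spine_def)
    next
      case False
      then have "h u = h v"
        using eq(2) by (simp add: off_def split: if_splits)
      then show ?thesis
        using h V by (auto simp: bij_betw_def dest: inj_onD)
    qed
  qed
  moreover have "r v \<le> r y" if e: "u \<rightarrow>\<^bsub>G\<^esub> v" "x \<rightarrow>\<^bsub>G\<^esub> y" "c u = c x" "r u < r x" for u v x y
  proof -
    have V: "u \<in> verts G" "v \<in> verts G" "x \<in> verts G" "y \<in> verts G"
      using adj_in_verts[OF e(1)] adj_in_verts[OF e(2)] by auto
    \<comment> \<open>Spine colors alternate and a leaf has the color opposite to its spine vertex,
      so this parity determines the color.\<close>
    define par where "par v = (even (ix v) = (v \<in> non_leaves G))" for v
    have par: "c v = c (vs ! 0) \<longleftrightarrow> par v" if v: "v \<in> verts G" for v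
    proof (cases "v \<in> non_leaves G")
      case True
      then show ?thesis
        using ix[OF v] alternating_color_parity[of vs c, OF alt, of "ix v"]
        by (simp add: par_def spine_def)
    next
      case False
      then have "v \<in> leaves G"
        using v by (simp add: non_leaves_def)
      then obtain w where "v \<rightarrow>\<^bsub>G\<^esub> w"
        using leaves_iff[OF assms(1)] by blast
      then have "c v \<noteq> c (spine v)"
        using spine_leaf[OF _ False] proper_coloringD[OF assms(4)] by auto
      then have "c v \<noteq> c (vs ! ix v)"
        using ix[OF v] by simp
      then show ?thesis
        using False ix[OF v] alternating_color_parity[of vs c, OF alt, of "ix v"]
        unfolding par_def by (cases "c v"; cases "c (vs ! ix v)"; cases "c (vs ! 0)") auto
    qed
    have edge: "u \<in> non_leaves G \<and> v \<in> non_leaves G \<and> (ix v = Suc (ix u) \<or> ix u = Suc (ix v)) \<or>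
        (u \<in> non_leaves G) \<noteq> (v \<in> non_leaves G) \<and> ix u = ix v" if "u \<rightarrow>\<^bsub>G\<^esub> v" for u v
    proof -
      have V: "u \<in> verts G" "v \<in> verts G"
        using adj_in_verts[OF that] by auto
      consider "u \<in> non_leaves G" "v \<in> non_leaves G" | "u \<notin> non_leaves G" | "v \<notin> non_leaves G"
        by blast
      then show ?thesis
      proof cases
        case 1
        then have "vs ! ix u = u" "vs ! ix v = v"
          using ix[OF V(1)] ix[OF V(2)] by (simp_all add: spine_def)
        then show ?thesis
          using 1 vs_adj[of "ix u" "ix v"] ix[OF V(1)] ix[OF V(2)] that by auto
      next
        case 2
        then have *: "spine u = v" "v \<in> non_leaves G"
          using spine_leaf[OF that] by auto
        then have "spine u = spine v"
          by (simp add: spine_def)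
        then show ?thesis
          using 2 * by (simp add: ix_def)
      next
        case 3
        then have *: "spine v = u" "u \<in> non_leaves G"
          using spine_leaf[OF graph_symmetric[OF that]] by auto
        then have "spine v = spine u"
          by (simp add: spine_def)
        then show ?thesis
          using 3 * by (simp add: ix_def)
      qed
    qed
    have less: "ix u < ix x \<or> ix u = ix x \<and> off u < off x"
      using e(4) lex_less_iff[OF off[OF V(1)] off[OF V(3)]] unfolding r_def of_nat_less_iff by simp
    have "par u \<longleftrightarrow> par x"
      using par[OF V(1)] par[OF V(3)] e(3) by simp
    then have same: "(even (ix u) = even (ix x)) = ((u \<in> non_leaves G) = (x \<in> non_leaves G))"
      unfolding par_def by blast
    have off0: "off w = 0 \<longleftrightarrow> w \<in> non_leaves G" for w
      by (simp add: off_def)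
    have "ix v < ix y \<or> ix v = ix y \<and> off v \<le> off y"
      by (rule caterpillar_order[OF edge[OF e(1)] edge[OF e(2)] same less off0 off0 off0 off0])
    then have "\<not> (ix y < ix v \<or> ix y = ix v \<and> off y < off v)"
      by auto
    then have "\<not> r y < r v"
      using lex_less_iff[OF off[OF V(4)] off[OF V(2)]] unfolding r_def of_nat_less_iff by simp
    then show ?thesis
      by simp
  qed
  ultimately show ?thesis
    unfolding two_layer_def by metis
qed

lemma caterpillar_two_color_universal:
  fixes G :: "('a, 'b) pre_digraph"
  assumes "graph G" "caterpillar G" "equitable_graph G" "card (non_leaves G) \<le> card (leaves G)"
    and bdc: "balanced_double_chain C1 C2"
  shows "two_color_universal (C1 \<union> C2) G"
  unfolding two_color_universal_def
proof (intro allI impI)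
  fix c d assume proper: "proper_coloring G c" and compat: "compatible_coloring G c (C1 \<union> C2) d"
  interpret graph G by fact
  have conn: "Digraph_Component.connected G"
    using assms(2) by (simp add: caterpillar_def undirected_tree_def)
  have equi: "equitable_coloring G c"
    using connected_equitable_coloring[OF assms(3) conn proper] .
  have part: "leaves G \<union> non_leaves G = verts G" "leaves G \<inter> non_leaves G = {}"
    by (auto simp: leaves_def non_leaves_def)
  have fin: "finite (leaves G)" "finite (non_leaves G)"
    by (simp_all add: leaves_def non_leaves_def)
  show "embeddable G c (C1 \<union> C2) d"
  proof (cases "non_leaves G = {}")
    case False
    obtain r where r: "two_layer G c r"
      using caterpillar_two_layer[OF assms(1,2) False proper] by blast
    have Z: "leaf_cover G (non_leaves G)"
      unfolding leaf_cover_def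
    proof (intro conjI allI impI)
      show "non_leaves G \<subseteq> verts G"
        using part by blast
      show "u \<in> non_leaves G \<or> v \<in> non_leaves G" if "u \<rightarrow>\<^bsub>G\<^esub> v" for u v
        using leaf_neighbor_not_leaf[OF assms(1) conn False that] adj_in_verts[OF that] part by blast
      show "v = w" if "u \<notin> non_leaves G" "u \<rightarrow>\<^bsub>G\<^esub> v" "u \<rightarrow>\<^bsub>G\<^esub> w" for u v w
      proof -
        have "u \<in> leaves G"
          using that(1) adj_in_verts[OF that(2)] part by blast
        then show ?thesis
          using that leaves_iff[OF assms(1)] by metis
      qed
    qed
    have "card (verts G) = card (leaves G) + card (non_leaves G)"
      using part fin by (metis card_Un_disjoint)
    then have card: "2 * card (non_leaves G) \<le> card (verts G)"
      using assms(4) by simp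
    obtain vs where vs: "distinct vs" "set vs = non_leaves G"
      and vs_adj: "\<And>i j. i < length vs \<Longrightarrow> j < length vs \<Longrightarrow> vs ! i \<rightarrow>\<^bsub>G\<^esub> vs ! j \<longleftrightarrow> j = Suc i \<or> i = Suc j"
      using caterpillar_spine[OF assms(2)] by metis
    have "c (vs ! i) \<noteq> c (vs ! Suc i)" if "Suc i < length vs" for i
      using vs_adj[of i "Suc i"] that proper_coloringD[OF proper] by auto
    then have "\<bar>int (card (color_class (non_leaves G) c Black)) - int (card (color_class (non_leaves G) c White))\<bar> \<le> 1"
      using alternating_color_counts[OF vs(1)] vs(2) by metis
    then show ?thesis
      using embeddable_if_balanced_leaf_cover[OF assms(1) bdc proper equi compat r Z card] by blast
  next
    \<comment> \<open>The caterpillar is a single edge without spine. One of its ends serves as the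
      cover, and as each color class is a single vertex, all positions may be 0.\<close>
    case True
    then have all: "verts G = leaves G"
      using part by auto
    obtain u where u: "u \<in> verts G"
      using connected_nonempty[OF conn] by blast
    then obtain v where v: "u \<rightarrow>\<^bsub>G\<^esub> v"
      using leaves_iff[OF assms(1)] all by metis
    have adj: "v \<in> verts G" "v \<rightarrow>\<^bsub>G\<^esub> u" "u \<noteq> v" "c u \<noteq> c v"
      using v adj_in_verts[OF v] graph_symmetric[OF v] adj_not_same proper_coloringD[OF proper v] by auto
    have unique: "y = z" if "x \<rightarrow>\<^bsub>G\<^esub> y" "x \<rightarrow>\<^bsub>G\<^esub> z" for x y z
      using that leaves_iff[OF assms(1), of x] all adj_in_verts(1)[OF that(1)] by metis
    have "verts G \<subseteq> {u, v}"
      using unique v adj(2)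
      by (intro connected_closed_set[OF assms(1) conn u]) (simp, metis insertCI insertE singletonD)
    then have V: "verts G = {u, v}"
      using u adj by auto
    have "inj_on (\<lambda>x. 0 :: real) (color_class (verts G) c k)" for k
      using adj(4) unfolding V by (auto simp: color_class_def inj_on_def)
    then have r: "two_layer G c (\<lambda>x. 0)"
      by (simp add: two_layer_def)
    have Z: "leaf_cover G {u}"
      unfolding leaf_cover_def
    proof (intro conjI allI impI)
      show "x \<in> {u} \<or> y \<in> {u}" if "x \<rightarrow>\<^bsub>G\<^esub> y" for x y
        using adj_in_verts[OF that] V that adj_not_same by auto
      show "y = z" if "x \<rightarrow>\<^bsub>G\<^esub> y" "x \<rightarrow>\<^bsub>G\<^esub> z" for x y z
        using unique that .
    qed (use u in simp)
    have "color_class {u} c k = (if c u = k then {u} else {})" for k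
      by (auto simp: color_class_def)
    then show ?thesis
      using embeddable_if_balanced_leaf_cover[OF assms(1) bdc proper equi compat r Z] V adj(3) by simp
  qed
qed

section \<open>Two-layer drawings\<close>

lemma two_layer_less:
  assumes "two_layer G c r" "u \<rightarrow>\<^bsub>G\<^esub> v" "x \<rightarrow>\<^bsub>G\<^esub> y" "c u = c x" "r u < r x"
  shows "r v \<le> r y"
  using assms unfolding two_layer_def by metis

lemma two_layer_inj:
  assumes "two_layer G c r" "u \<in> verts G" "v \<in> verts G" "c u = c v" "r u = r v"
  shows "u = v"
proof -
  have "inj_on r (color_class (verts G) c (c u))"
    using assms(1) unfolding two_layer_def by blast
  then show ?thesis
    by (rule inj_onD) (use assms in \<open>simp_all add: color_class_def\<close>)
qed

lemma same_color_if_common_neighbor: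
  assumes "proper_coloring G c" "x \<rightarrow>\<^bsub>G\<^esub> w" "b \<rightarrow>\<^bsub>G\<^esub> w"
  shows "c b = c x"
  using proper_coloringD[OF assms(1,2)] proper_coloringD[OF assms(1,3)] color_cases[of "c x" "c w" "c b"]
  by auto

text \<open>
  The leftmost vertex of its color in \<open>X\<close> has two neighbors, and the left one of these is joined
  to a vertex further right.
\<close>

lemma two_layer_min_degree:
  assumes "graph G" "two_layer G c r" "proper_coloring G c" "X \<subseteq> verts G" "X \<noteq> {}"
    and two: "\<And>v. v \<in> X \<Longrightarrow> \<exists>w\<in>X. \<exists>x\<in>X. w \<noteq> x \<and> v \<rightarrow>\<^bsub>G\<^esub> w \<and> v \<rightarrow>\<^bsub>G\<^esub> x"
  shows False
proof -
  interpret graph G by fact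
  obtain v0 where "v0 \<in> X"
    using assms(5) by blast
  define K where "K = color_class X c (c v0)"
  have "finite K" "K \<noteq> {}"
    using \<open>v0 \<in> X\<close> finite_subset[OF assms(4)] by (auto simp: K_def color_class_def)
  then obtain b where b: "b \<in> K" "\<And>x. x \<in> K \<Longrightarrow> r b \<le> r x"
    using ex_is_arg_min_if_finite[of K r] by (auto simp: is_arg_min_linorder)
  have bX: "b \<in> X" "c b = c v0"
    using b(1) by (auto simp: K_def color_class_def)
  obtain w1 w2 where w: "w1 \<in> X" "w2 \<in> X" "w1 \<noteq> w2" "b \<rightarrow>\<^bsub>G\<^esub> w1" "b \<rightarrow>\<^bsub>G\<^esub> w2" "r w1 \<le> r w2"
    using two[OF bX(1)] by (metis linear)
  have "c w1 = c w2"
    using same_color_if_common_neighbor[OF assms(3) graph_symmetric[OF w(5)] graph_symmetric[OF w(4)]] .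
  then have less: "r w1 < r w2"
    using two_layer_inj[OF assms(2)] w assms(4) by (metis less_le subsetD)
  obtain b' where b': "b' \<in> X" "w1 \<rightarrow>\<^bsub>G\<^esub> b'" "b' \<noteq> b"
    using two[OF w(1)] by metis
  have cb: "c b' = c b"
    using same_color_if_common_neighbor[OF assms(3) w(4) graph_symmetric[OF b'(2)]] .
  then have "b' \<in> K"
    using b'(1) bX by (simp add: K_def color_class_def)
  then have "r b < r b'"
    using b(2) two_layer_inj[OF assms(2)] b' bX cb assms(4) by (metis less_le subsetD)
  then have "r w2 \<le> r w1"
    using two_layer_less[OF assms(2) w(5) graph_symmetric[OF b'(2)]] cb by simp
  then show False
    using less by simp
qed

text \<open>If \<open>b\<close> were left of \<open>x\<close>, the edges \<open>b v\<close> and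
  \<open>x u\<close> would be inverted; if it were right of \<open>x\<close>, the edges
  \<open>b v\<close> and \<open>x w\<close> would be.\<close>

lemma two_layer_middle_neighbor:
  assumes "graph G" "two_layer G c r" "proper_coloring G c"
    and "x \<rightarrow>\<^bsub>G\<^esub> u" "x \<rightarrow>\<^bsub>G\<^esub> v" "x \<rightarrow>\<^bsub>G\<^esub> w" "r u < r v" "r v < r w" "v \<rightarrow>\<^bsub>G\<^esub> b"
  shows "b = x"
proof -
  interpret graph G by fact
  have b: "b \<rightarrow>\<^bsub>G\<^esub> v"
    using assms(9) by (rule graph_symmetric)
  have c: "c b = c x"
    using same_color_if_common_neighbor[OF assms(3,5) b] .
  have "\<not> r b < r x"
    using two_layer_less[OF assms(2) b assms(4) c] assms(7) by linarith
  moreover have "\<not> r x < r b"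
    using two_layer_less[OF assms(2) assms(6) b c[symmetric]] assms(8) by linarith
  ultimately show ?thesis
    using two_layer_inj[OF assms(2)] adj_in_verts(1)[OF b] adj_in_verts(1)[OF assms(4)] c by simp
qed

text \<open>The three neighbors have the same color and hence distinct positions; the middle one
  cannot have a neighbor besides \<open>x\<close>.\<close>

lemma two_layer_no_spider:
  assumes "graph G" "two_layer G c r" "proper_coloring G c"
    and adj: "\<And>v. v \<in> {v1, v2, v3} \<Longrightarrow> x \<rightarrow>\<^bsub>G\<^esub> v"
    and other: "\<And>v. v \<in> {v1, v2, v3} \<Longrightarrow> \<exists>b. v \<rightarrow>\<^bsub>G\<^esub> b \<and> b \<noteq> x"
    and distinct: "v1 \<noteq> v2" "v1 \<noteq> v3" "v2 \<noteq> v3"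
  shows False
proof -
  interpret graph G by fact
  have ne: "r u \<noteq> r v" if "u \<in> {v1, v2, v3}" "v \<in> {v1, v2, v3}" "u \<noteq> v" for u v
  proof
    assume "r u = r v"
    moreover have "c u = c v"
      using same_color_if_common_neighbor[OF assms(3) graph_symmetric[OF adj[OF that(2)]]
          graph_symmetric[OF adj[OF that(1)]]] .
    ultimately show False
      using two_layer_inj[OF assms(2) adj_in_verts(2)[OF adj[OF that(1)]] adj_in_verts(2)[OF adj[OF that(2)]]]
        that(3) by blast
  qed
  have *: False if "u \<in> {v1, v2, v3}" "v \<in> {v1, v2, v3}" "w \<in> {v1, v2, v3}" "r u < r v" "r v < r w" for u v w
    using two_layer_middle_neighbor[OF assms(1-3) adj[OF that(1)] adj[OF that(2)] adj[OF that(3)] that(4,5)]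
      other[OF that(2)] by blast
  have "r v1 \<noteq> r v2" "r v1 \<noteq> r v3" "r v2 \<noteq> r v3"
    using ne[of v1 v2] ne[of v1 v3] ne[of v2 v3] distinct by simp_all
  then consider "r v1 < r v2" "r v2 < r v3" | "r v1 < r v3" "r v3 < r v2" | "r v2 < r v1" "r v1 < r v3"
    | "r v2 < r v3" "r v3 < r v1" | "r v3 < r v1" "r v1 < r v2" | "r v3 < r v2" "r v2 < r v1"
    by linarith
  then show False
    by cases (use * in blast)+
qed

section \<open>Cycles, and the spine of a two-layer drawing\<close>

context pre_digraph
begin

lemma cas_nth:
  assumes "cas u p v"
  shows "Suc i < length p \<Longrightarrow> head G (p ! i) = tail G (p ! Suc i)"
    and "p \<noteq> [] \<Longrightarrow> tail G (p ! 0) = u" "p \<noteq> [] \<Longrightarrow> head G (p ! (length p - 1)) = v"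
proof -
  have "(\<forall>i. Suc i < length p \<longrightarrow> head G (p ! i) = tail G (p ! Suc i)) \<and>
    (p \<noteq> [] \<longrightarrow> tail G (p ! 0) = u \<and> head G (p ! (length p - 1)) = v)"
    using assms
  proof (induction u p v rule: cas.induct)
    case (2 u e es v)
    then have IH: "\<forall>i. Suc i < length es \<longrightarrow> head G (es ! i) = tail G (es ! Suc i)"
      "es \<noteq> [] \<longrightarrow> tail G (es ! 0) = head G e \<and> head G (es ! (length es - 1)) = v" "tail G e = u"
      "es = [] \<longrightarrow> head G e = v"
      by (auto simp del: cas.simps(2) simp: cas.simps)
    have "head G ((e # es) ! i) = tail G ((e # es) ! Suc i)" if "Suc i < length (e # es)" for i
      using that IH by (cases i) auto
    then show ?case
      using IH by (cases es) auto
  qed simp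
  then show "Suc i < length p \<Longrightarrow> head G (p ! i) = tail G (p ! Suc i)"
    and "p \<noteq> [] \<Longrightarrow> tail G (p ! 0) = u" "p \<noteq> [] \<Longrightarrow> head G (p ! (length p - 1)) = v"
    by blast+
qed

end

text \<open>Provides the set to which \<open>two_layer_min_degree\<close> is applied in order to
  exclude cycles.\<close>

lemma cycle_min_degree:
  assumes "graph G" "pre_digraph.cycle G p" "3 \<le> length p"
  defines "X \<equiv> set (map (head G) p)"
  shows "X \<subseteq> verts G" "X \<noteq> {}" "v \<in> X \<Longrightarrow> \<exists>w\<in>X. \<exists>x\<in>X. w \<noteq> x \<and> v \<rightarrow>\<^bsub>G\<^esub> w \<and> v \<rightarrow>\<^bsub>G\<^esub> x"
proof -
  interpret graph G by fact
  obtain u where u: "awalk u p u" "distinct (tl (awalk_verts u p))"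
    using assms(2) by (auto simp: cycle_def)
  have cas: "cas u p u" and arcs: "set p \<subseteq> arcs G"
    using u(1) by (auto simp: awalk_def)
  have ne: "p \<noteq> []"
    using assms(3) by auto
  have dist: "distinct (map (head G) p)"
    using u(2) awalk_verts_conv'[OF cas] ne by simp
  show "X \<subseteq> verts G" "X \<noteq> {}"
    using arcs ne by (auto simp: X_def)
  let ?n = "length p"
  \<comment> \<open>Cyclic successor and predecessor of an index. They are distinct because there
    are at least three arcs; an edge traversed back and forth would make them equal.\<close>
  define nx where "nx i = (if Suc i < ?n then Suc i else 0)" for i
  define pv where "pv i = (if i = 0 then ?n - 1 else i - 1)" for i
  assume "v \<in> X"
  then obtain i where i: "i < ?n" "v = head G (p ! i)"
    by (auto simp: X_def in_set_conv_nth)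
  have bounds: "nx i < ?n" "pv i < ?n" "nx i \<noteq> pv i"
    using i(1) assms(3) by (auto simp: nx_def pv_def)
  have next_tail: "tail G (p ! nx i) = v"
  proof (cases "Suc i < ?n")
    case True
    then show ?thesis
      using cas_nth(1)[OF cas True] i(2) by (simp add: nx_def)
  next
    case False
    then have "i = ?n - 1"
      using i(1) by simp
    then show ?thesis
      using cas_nth(2,3)[OF cas ne] False i(2) by (simp add: nx_def)
  qed
  have prev_tail: "tail G (p ! i) = head G (p ! pv i)"
  proof (cases i)
    case 0
    then show ?thesis
      using cas_nth(2,3)[OF cas ne] by (simp add: pv_def)
  next
    case (Suc j)
    then show ?thesis
      using cas_nth(1)[OF cas, of j] i(1) by (simp add: pv_def)
  qed
  have "p ! nx i \<in> arcs G" "p ! i \<in> arcs G"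
    using arcs bounds(1) i(1) nth_mem by blast+
  then have "v \<rightarrow>\<^bsub>G\<^esub> head G (p ! nx i)" "head G (p ! pv i) \<rightarrow>\<^bsub>G\<^esub> v"
    using next_tail prev_tail i(2) dominatesI[of "p ! nx i"] dominatesI[of "p ! i"]
    by (simp_all add: arc_to_ends_def)
  moreover have "head G (p ! nx i) \<noteq> head G (p ! pv i)"
    using nth_eq_iff_index_eq[OF dist, of "nx i" "pv i"] bounds by simp
  moreover have "head G (p ! nx i) \<in> X" "head G (p ! pv i) \<in> X"
    using bounds by (auto simp: X_def)
  ultimately show "\<exists>w\<in>X. \<exists>x\<in>X. w \<noteq> x \<and> v \<rightarrow>\<^bsub>G\<^esub> w \<and> v \<rightarrow>\<^bsub>G\<^esub> x"
    using graph_symmetric by blast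
qed

text \<open>
  A longest path inside the set of non-leaves is chordless, and by connectivity and the absence
  of spiders it exhausts this set.
\<close>

lemma two_layer_spine:
  assumes "graph G" "Digraph_Component.connected G" "two_layer G c r" "proper_coloring G c"
  shows "\<exists>vs. distinct vs \<and> set vs = non_leaves G \<and>
    (\<forall>i < length vs. \<forall>j < length vs. vs ! i \<rightarrow>\<^bsub>G\<^esub> vs ! j \<longleftrightarrow> j = Suc i \<or> i = Suc j)"
proof (cases "\<exists>x\<in>verts G. \<forall>y. \<not> x \<rightarrow>\<^bsub>G\<^esub> y")
  case True
  then obtain x where x: "x \<in> verts G" "\<And>y. \<not> x \<rightarrow>\<^bsub>G\<^esub> y"
    by blast
  have "verts G \<subseteq> {x}"
    by (rule connected_closed_set[OF assms(1,2) x(1)]) (use x(2) in auto)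
  then have "non_leaves G = {x}"
    using x leaves_iff[OF assms(1)] by (auto simp: non_leaves_def)
  then show ?thesis
    using x(2) by (intro exI[of _ "[x]"]) simp
next
  case False
  interpret graph G by fact
  let ?D = "non_leaves G"
  \<comment> \<open>Isolated vertices are non-leaves of degree 0. They were settled in the previous
    case, so that here every non-leaf has at least two neighbors.\<close>
  have two: "\<exists>w. v \<rightarrow>\<^bsub>G\<^esub> w \<and> w \<noteq> x" if v: "v \<in> ?D" for v x
  proof -
    obtain w where w: "v \<rightarrow>\<^bsub>G\<^esub> w"
      using v False by (auto simp: non_leaves_def)
    then obtain w' where "v \<rightarrow>\<^bsub>G\<^esub> w'" "w' \<noteq> w"
      using v leaves_iff[OF assms(1), of v] unfolding non_leaves_def by blast
    then show ?thesis
      using w by metis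
  qed
  define is_path where "is_path vs \<longleftrightarrow> distinct vs \<and> set vs \<subseteq> ?D \<and>
    (\<forall>i. Suc i < length vs \<longrightarrow> vs ! i \<rightarrow>\<^bsub>G\<^esub> vs ! Suc i)" for vs
  have finD: "finite ?D"
    by (simp add: non_leaves_def)
  have "length vs < Suc (card ?D)" if "is_path vs" for vs
    using that finD by (metis card_mono distinct_card is_path_def le_imp_less_Suc)
  moreover have "is_path []"
    by (simp add: is_path_def)
  ultimately obtain vs where path: "is_path vs" and longest: "\<And>us. is_path us \<Longrightarrow> length us \<le> length vs"
    using ex_has_greatest_nat[of is_path "[]" length "Suc (card ?D)"] by metis
  have dist: "distinct vs" and sub: "set vs \<subseteq> ?D" and step: "\<And>i. Suc i < length vs \<Longrightarrow> vs ! i \<rightarrow>\<^bsub>G\<^esub> vs ! Suc i"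
    using path by (simp_all add: is_path_def)
  \<comment> \<open>A chord closes a cycle on the path vertices from \<open>i\<close> to
    \<open>j\<close>, each of which then has two neighbors among them.\<close>
  have chord: "j = Suc i" if e: "vs ! i \<rightarrow>\<^bsub>G\<^esub> vs ! j" and ij: "i < j" "j < length vs" for i j
  proof (rule ccontr)
    assume "j \<noteq> Suc i"
    then have gap: "Suc i < j"
      using ij by simp
    let ?X = "(\<lambda>k. vs ! k) ` {i..j}"
    have in_X: "vs ! k \<in> ?X" if "i \<le> k" "k \<le> j" for k
      using that by simp
    show False
    proof (rule two_layer_min_degree[OF assms(1,3,4)])
      show "?X \<subseteq> verts G"
      proof (rule image_subsetI)
        fix k assume "k \<in> {i..j}"
        then have "vs ! k \<in> set vs"
          using ij by simp
        then show "vs ! k \<in> verts G"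
          using sub by (auto simp: non_leaves_def)
      qed
      show "?X \<noteq> {}"
        using ij by simp
      fix v assume "v \<in> ?X"
      then obtain k where k: "i \<le> k" "k \<le> j" "v = vs ! k"
        by auto
      have neq: "vs ! a \<noteq> vs ! b" if "a < b" "b \<le> j" for a b
        using nth_eq_iff_index_eq[OF dist, of a b] that ij by simp
      consider "k = i" | "k = j" | "i < k" "k < j"
        using k by linarith
      then show "\<exists>w\<in>?X. \<exists>x\<in>?X. w \<noteq> x \<and> v \<rightarrow>\<^bsub>G\<^esub> w \<and> v \<rightarrow>\<^bsub>G\<^esub> x"
      proof cases
        case 1
        then show ?thesis
          using step[of i] e k neq[of "Suc i" j] gap ij
          by (intro bexI[OF _ in_X[of "Suc i"]] bexI[OF _ in_X[of j]]) simp_all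
      next
        case 2
        have "vs ! (j - 1) \<rightarrow>\<^bsub>G\<^esub> vs ! j"
          using step[of "j - 1"] gap ij by simp
        then show ?thesis
          using graph_symmetric e k 2 neq[of i "j - 1"] gap ij
          by (intro bexI[OF _ in_X[of i]] bexI[OF _ in_X[of "j - 1"]]) simp_all
      next
        case 3
        have "vs ! (k - 1) \<rightarrow>\<^bsub>G\<^esub> vs ! k"
          using step[of "k - 1"] 3 ij by simp
        then show ?thesis
          using graph_symmetric step[of k] k 3 neq[of "k - 1" "Suc k"] ij
          by (intro bexI[OF _ in_X[of "k - 1"]] bexI[OF _ in_X[of "Suc k"]]) simp_all
      qed
    qed
  qed
  have adj: "vs ! i \<rightarrow>\<^bsub>G\<^esub> vs ! j \<longleftrightarrow> j = Suc i \<or> i = Suc j" if ij: "i < length vs" "j < length vs" for i j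
  proof
    assume e: "vs ! i \<rightarrow>\<^bsub>G\<^esub> vs ! j"
    then have "i \<noteq> j"
      using adj_not_same by blast
    then consider "i < j" | "j < i"
      by linarith
    then show "j = Suc i \<or> i = Suc j"
      by cases (use chord e graph_symmetric ij in blast)+
  next
    assume "j = Suc i \<or> i = Suc j"
    then show "vs ! i \<rightarrow>\<^bsub>G\<^esub> vs ! j"
      using step[of i] graph_symmetric[OF step[of j]] ij by auto
  qed
  have "?D \<subseteq> set vs"
  proof (rule ccontr)
    assume "\<not> ?D \<subseteq> set vs"
    then obtain w where w: "w \<in> ?D" "w \<notin> set vs"
      by blast
    have "vs \<noteq> []"
      using longest[of "[w]"] w(1) by (auto simp: is_path_def)
    then have hd: "vs ! 0 \<in> set vs"
      by simp
    have "\<exists>p\<in>set vs. \<exists>v\<in>?D - set vs. p \<rightarrow>\<^bsub>G\<^esub> v"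
    proof (rule ccontr)
      assume no: "\<not> ?thesis"
      \<comment> \<open>The path together with the leaves attached to it. If no other non-leaf is
        adjacent to the path, this set is closed under adjacency, hence everything.\<close>
      define T where "T = set vs \<union> {x. x \<notin> ?D \<and> (\<exists>p\<in>set vs. p \<rightarrow>\<^bsub>G\<^esub> x)}"
      have "verts G \<subseteq> T"
      proof (rule connected_closed_set[OF assms(1,2)])
        show "vs ! 0 \<in> verts G" "vs ! 0 \<in> T"
          using hd sub by (auto simp: non_leaves_def T_def)
        fix x y assume x: "x \<in> T" "x \<rightarrow>\<^bsub>G\<^esub> y"
        show "y \<in> T"
        proof (cases "x \<in> set vs")
          case True
          then show ?thesis
            using no x(2) unfolding T_def by blast
        next
          case False
          then obtain p where p: "x \<notin> ?D" "p \<in> set vs" "p \<rightarrow>\<^bsub>G\<^esub> x"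
            using x(1) by (auto simp: T_def)
          then have "x \<in> leaves G"
            using adj_in_verts(2)[OF p(3)] by (simp add: non_leaves_def)
          then have "y = p"
            using leaves_iff[OF assms(1), of x] x(2) graph_symmetric[OF p(3)] by metis
          then show ?thesis
            using p(2) by (simp add: T_def)
        qed
      qed
      then show False
        using w by (auto simp: T_def non_leaves_def)
    qed
    then obtain i v where i: "i < length vs" and v: "v \<in> ?D" "v \<notin> set vs" "vs ! i \<rightarrow>\<^bsub>G\<^esub> v"
      by (auto simp: in_set_conv_nth)
    \<comment> \<open>Attached to an end of the path, \<open>v\<close> would lengthen it; attached
      to an inner vertex, it is a third neighbor that is a non-leaf.\<close>
    consider "i = 0" | "Suc i = length vs" | "0 < i" "Suc i < length vs"
      using i by linarith
    then show False
    proof cases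
      case 1
      have "is_path (v # vs)"
        unfolding is_path_def
      proof (intro conjI allI impI)
        show "(v # vs) ! k \<rightarrow>\<^bsub>G\<^esub> (v # vs) ! Suc k" if "Suc k < length (v # vs)" for k
          using that step[of "k - 1"] graph_symmetric[OF v(3)] 1 by (cases k) simp_all
      qed (use v dist sub in simp_all)
      then show False
        using longest[of "v # vs"] by simp
    next
      case 2
      have "is_path (vs @ [v])"
        unfolding is_path_def
      proof (intro conjI allI impI)
        show "(vs @ [v]) ! k \<rightarrow>\<^bsub>G\<^esub> (vs @ [v]) ! Suc k" if k: "Suc k < length (vs @ [v])" for k
        proof (cases "Suc k < length vs")
          case True
          then show ?thesis
            using step[of k] by (simp add: nth_append)
        next
          case False
          then have "k = i"
            using k 2 by simp
          then show ?thesis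
            using v(3) 2 i by (simp add: nth_append)
        qed
      qed (use v dist sub in simp_all)
      then show False
        using longest[of "vs @ [v]"] by simp
    next
      case 3
      have prev: "vs ! i \<rightarrow>\<^bsub>G\<^esub> vs ! (i - 1)"
        using step[of "i - 1"] 3 i graph_symmetric by simp
      have D: "vs ! (i - 1) \<in> ?D" "vs ! Suc i \<in> ?D"
        using sub 3 i by (auto dest: nth_mem)
      have "vs ! (i - 1) \<noteq> vs ! Suc i"
        using nth_eq_iff_index_eq[OF dist, of "i - 1" "Suc i"] 3 by simp
      moreover have "vs ! (i - 1) \<noteq> v" "vs ! Suc i \<noteq> v"
        using v(2) 3 i by auto
      moreover have "vs ! i \<rightarrow>\<^bsub>G\<^esub> x" if "x \<in> {vs ! (i - 1), vs ! Suc i, v}" for x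
        using that prev step[OF 3(2)] v(3) by auto
      moreover have "\<exists>b. x \<rightarrow>\<^bsub>G\<^esub> b \<and> b \<noteq> vs ! i" if "x \<in> {vs ! (i - 1), vs ! Suc i, v}" for x
        using that two D v(1) by auto
      ultimately show False
        using two_layer_no_spider[OF assms(1,3,4), of "vs ! (i - 1)" "vs ! Suc i" v "vs ! i"] by simp
    qed
  qed
  then show ?thesis
    using dist sub adj by (intro exI[of _ vs]) auto
qed

section \<open>From universality to forests of caterpillars\<close>

lemma two_layer_caterpillar:
  assumes "graph G" "strongly_connected G" "two_layer G c r" "proper_coloring G c"
  shows "caterpillar G"
proof -
  interpret graph G by fact
  have conn: "Digraph_Component.connected G"
    using assms(2) reachable_mk_symmetricI unfolding connected_def strongly_connected_def by simp
  have no_cycle: False if "cycle p" "3 \<le> length p" for p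
    by (rule two_layer_min_degree[OF assms(1,3,4) cycle_min_degree[OF assms(1) that]])
  obtain vs where vs: "distinct vs" "set vs = non_leaves G"
    "\<forall>i < length vs. \<forall>j < length vs. vs ! i \<rightarrow>\<^bsub>G\<^esub> vs ! j \<longleftrightarrow> j = Suc i \<or> i = Suc j"
    using two_layer_spine[OF assms(1) conn assms(3,4)] by blast
  have "u \<rightarrow>\<^bsub>G \<restriction> non_leaves G\<^esub> v \<longleftrightarrow> u \<rightarrow>\<^bsub>G\<^esub> v" if "u \<in> non_leaves G" "v \<in> non_leaves G" for u v
    using that by (auto simp: arcs_ends_conv image_iff)
  then have "vs ! i \<rightarrow>\<^bsub>G \<restriction> non_leaves G\<^esub> vs ! j \<longleftrightarrow> j = Suc i \<or> i = Suc j"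
    if "i < length vs" "j < length vs" for i j
    using vs(2,3) that nth_mem by metis
  then have "path_graph (G \<restriction> non_leaves G)"
    unfolding path_graph_def using vs(1,2) by (intro exI[of _ vs]) simp
  then show ?thesis
    using assms(1) conn no_cycle unfolding caterpillar_def undirected_tree_def by metis
qed

lemma two_layer_forest_of_caterpillars:
  fixes G :: "('a, 'b) pre_digraph"
  assumes "graph G" "two_layer G c r" "proper_coloring G c"
  shows "forest_of_caterpillars G"
  unfolding forest_of_caterpillars_def
proof (intro conjI ballI)
  interpret graph G by fact
  fix H assume "H \<in> sccs"
  then have H: "induced_subgraph H G" "strongly_connected H"
    by (auto simp: sccs_def)
  interpret H: digraph H
    using H(1) by (rule digraphI_induced)
  have "graph H"
    using H.graphI induced_graph_imp_symmetric[OF sym_arcs H(1)] by blast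
  have sub: "subgraph H G"
    using H(1) by (rule induced_imp_subgraph)
  have arcs: "u \<rightarrow>\<^bsub>G\<^esub> v" if "u \<rightarrow>\<^bsub>H\<^esub> v" for u v
    using arcs_ends_mono[OF sub] that by blast
  have "verts H \<subseteq> verts G"
    using sub by (rule subgraph_imp_subverts)
  then have "color_class (verts H) c k \<subseteq> color_class (verts G) c k" for k
    by (auto simp: color_class_def)
  then have "inj_on r (color_class (verts H) c k)" for k
    using assms(2) unfolding two_layer_def by (metis inj_on_subset)
  moreover have "r v \<le> r y" if "u \<rightarrow>\<^bsub>H\<^esub> v" "x \<rightarrow>\<^bsub>H\<^esub> y" "c u = c x" "r u < r x" for u v x y
    using two_layer_less[OF assms(2) arcs[OF that(1)] arcs[OF that(2)] that(3,4)] .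
  ultimately have "two_layer H c r"
    unfolding two_layer_def by metis
  moreover have "proper_coloring H c"
    using assms(3) arcs by (simp add: proper_coloring_def)
  ultimately show "caterpillar H"
    using two_layer_caterpillar[OF \<open>graph H\<close> H(2)] by blast
qed fact

text \<open>The abscissa of the image serves as position on both layers: two edges inverted by it
  would be crossing bridges without a common end.\<close>

lemma embeddable_bichromatic_two_layer:
  fixes G :: "('a, 'b) pre_digraph"
  assumes "graph G" "double_chain C1 C2" "proper_coloring G c" "k \<noteq> k'"
    and emb: "embeddable G c (C1 \<union> C2) (\<lambda>p. if p \<in> C1 then k else k')"
  shows "\<exists>r. two_layer G c r"
proof -
  interpret graph G by fact
  obtain \<phi> where bij: "bij_betw \<phi> (verts G) (C1 \<union> C2)"
    and color: "\<And>v. v \<in> verts G \<Longrightarrow> (if \<phi> v \<in> C1 then k else k') = c v"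
    and nc: "noncrossing G \<phi>"
    using emb unfolding embeddable_def by blast
  note side1 = double_chain_sides(1)[OF assms(2)] and side2 = double_chain_sides(2)[OF assms(2)]
  have chain: "c v = k \<and> \<phi> v \<in> C1 \<or> c v = k' \<and> \<phi> v \<in> C2" if "v \<in> verts G" for v
    using color[OF that] bij_betwE[OF bij] that by (auto split: if_splits)
  have inj: "u = v" if "u \<in> verts G" "v \<in> verts G" "\<phi> u = \<phi> v" for u v
    using bij that by (auto simp: bij_betw_def dest: inj_onD)
  have "inj_on (\<lambda>v. fst (\<phi> v)) (color_class (verts G) c j)" for j
  proof (rule inj_onI)
    fix u v assume *: "u \<in> color_class (verts G) c j" "v \<in> color_class (verts G) c j" "fst (\<phi> u) = fst (\<phi> v)"
    then have V: "u \<in> verts G" "v \<in> verts G" "c u = c v"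
      by (simp_all add: color_class_def)
    then have "\<phi> u \<in> C1 \<and> \<phi> v \<in> C1 \<or> \<phi> u \<in> C2 \<and> \<phi> v \<in> C2"
      using chain[OF V(1)] chain[OF V(2)] assms(4) by auto
    then have "\<phi> u = \<phi> v"
      using chain_sideD(2)[OF side1] chain_sideD(2)[OF side2] *(3) by (auto dest: inj_onD)
    then show "u = v"
      using inj V by blast
  qed
  moreover have "fst (\<phi> v) \<le> fst (\<phi> y)"
    if e: "u \<rightarrow>\<^bsub>G\<^esub> v" "x \<rightarrow>\<^bsub>G\<^esub> y" "c u = c x" "fst (\<phi> u) < fst (\<phi> x)" for u v x y
  proof (rule ccontr)
    assume "\<not> fst (\<phi> v) \<le> fst (\<phi> y)"
    then have less: "fst (\<phi> y) < fst (\<phi> v)"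
      by simp
    have V: "u \<in> verts G" "v \<in> verts G" "x \<in> verts G" "y \<in> verts G"
      using adj_in_verts[OF e(1)] adj_in_verts[OF e(2)] by auto
    have c: "c u \<noteq> c v" "c x \<noteq> c y"
      using proper_coloringD[OF assms(3)] e(1,2) by blast+
    have ne: "u \<noteq> x" "u \<noteq> y" "v \<noteq> x" "v \<noteq> y"
      using e(3,4) less c by auto
    have "closed_segment (\<phi> u) (\<phi> v) \<inter> closed_segment (\<phi> x) (\<phi> y) \<subseteq> {\<phi> u, \<phi> v} \<inter> {\<phi> x, \<phi> y}"
      using nc e(1,2) ne unfolding noncrossing_def by (simp add: doubleton_eq_iff)
    moreover have "{\<phi> u, \<phi> v} \<inter> {\<phi> x, \<phi> y} = {}"
      using inj V ne by auto
    moreover consider "\<phi> u \<in> C1" "\<phi> x \<in> C1" "\<phi> v \<in> C2" "\<phi> y \<in> C2"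
      | "\<phi> u \<in> C2" "\<phi> x \<in> C2" "\<phi> v \<in> C1" "\<phi> y \<in> C1"
      using chain[OF V(1)] chain[OF V(2)] chain[OF V(3)] chain[OF V(4)] c e(3) assms(4) by metis
    then have "closed_segment (\<phi> u) (\<phi> v) \<inter> closed_segment (\<phi> x) (\<phi> y) \<noteq> {}"
    proof cases
      case 1
      then show ?thesis
        using bridges_cross[OF side1 side2, of "\<phi> u" "\<phi> x" "\<phi> y" "\<phi> v"] e(4) less by blast
    next
      case 2
      have "chain_side (- (- 1)) C1 C2"
        using side1 by simp
      from bridges_cross[OF side2 this 2(1,2,4,3) e(4) less] show ?thesis .
    qed
    ultimately show False
      by blast
  qed
  ultimately show ?thesis
    unfolding two_layer_def by (intro exI[of _ "\<lambda>v. fst (\<phi> v)"]) blast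
qed

lemma universal_double_chain_forest_of_caterpillars:
  fixes G :: "('a, 'b) pre_digraph"
  assumes "equitable_graph G" and bdc: "balanced_double_chain C1 C2" and card: "card (C1 \<union> C2) = card (verts G)"
    and univ: "two_color_universal (C1 \<union> C2) G"
  shows "forest_of_caterpillars G"
proof -
  obtain c where c: "graph G" "proper_coloring G c" "equitable_coloring G c"
    using assms(1) by (auto simp: equitable_graph_def)
  interpret graph G by fact
  have dc: "double_chain C1 C2" and fin: "finite C1" "finite C2" and disj: "C1 \<inter> C2 = {}"
    using bdc by (auto simp: balanced_double_chain_def double_chain_def convex_chain_def concave_chain_def)
  have sizes: "card C1 + card C2 = card (color_class (verts G) c Black) + card (color_class (verts G) c White)"
    using card card_Un_disjoint[OF fin disj] card_color_classes[OF finite_verts, of Black White c] by simp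
  \<comment> \<open>The sizes of the two chains and of the two color classes have the same sum, and
    each pair differs by at most 1. So the pairs coincide up to order, and each chain can take one
    whole color class.\<close>
  obtain k k' where k: "k \<noteq> k'" "card (color_class (verts G) c k) = card C1"
    "card (color_class (verts G) c k') = card C2"
  proof (cases "card (color_class (verts G) c Black) = card C1")
    case True
    then show thesis
      using that[of Black White] sizes by simp
  next
    case False
    then have "card (color_class (verts G) c White) = card C1"
      using sizes bdc c(3) unfolding balanced_double_chain_def equitable_coloring_def by linarith
    then show thesis
      using that[of White Black] sizes by simp
  qed
  define d where "d p = (if p \<in> C1 then k else k')" for p
  have "color_class (C1 \<union> C2) d k = C1" "color_class (C1 \<union> C2) d k' = C2"
    using k(1) disj by (auto simp: color_class_def d_def)
  then have "card (color_class (C1 \<union> C2) d j) = card (color_class (verts G) c j)" for j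
    using k color_cases[OF k(1), of j] by auto
  then have "compatible_coloring G c (C1 \<union> C2) d"
    using fin card by (simp add: compatible_coloring_def)
  then have "embeddable G c (C1 \<union> C2) d"
    using univ c(2) by (simp add: two_color_universal_def)
  then obtain r where "two_layer G c r"
    using embeddable_bichromatic_two_layer[OF c(1) dc c(2) k(1)] unfolding d_def by blast
  then show ?thesis
    using two_layer_forest_of_caterpillars[OF c(1) _ c(2)] by blast
qed

theorem theorem3:
  fixes G :: "('a, 'b) pre_digraph" and n :: nat
  assumes "graph G" and "card (verts G) = n"
  shows
    "(caterpillar G \<and> equitable_graph G \<and> card (non_leaves G) \<le> card (leaves G) \<longrightarrow>
        (\<forall>C1 C2. balanced_double_chain C1 C2 \<and> card (C1 \<union> C2) = n \<longrightarrow>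
           two_color_universal (C1 \<union> C2) G)) \<and>
     (forest_of_stars G \<longrightarrow>
        (\<forall>c. proper_coloring G c \<and> equitable_coloring G c \<longrightarrow>
          (\<forall>C1 C2 d. balanced_double_chain C1 C2 \<and> card (C1 \<union> C2) = n \<and>
              compatible_coloring G c (C1 \<union> C2) d \<longrightarrow>
            embeddable G c (C1 \<union> C2) d))) \<and>
     (equitable_graph G \<and>
        (\<exists>C1 C2. balanced_double_chain C1 C2 \<and> card (C1 \<union> C2) = n \<and>
           two_color_universal (C1 \<union> C2) G) \<longrightarrow>
      forest_of_caterpillars G)"
proof (intro conjI impI allI)
  fix C1 C2
  assume "caterpillar G \<and> equitable_graph G \<and> card (non_leaves G) \<le> card (leaves G)"
    and "balanced_double_chain C1 C2 \<and> card (C1 \<union> C2) = n"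
  then show "two_color_universal (C1 \<union> C2) G"
    using caterpillar_two_color_universal[OF assms(1)] by simp
next
  fix c C1 C2 d
  assume "forest_of_stars G" "proper_coloring G c \<and> equitable_coloring G c"
    and "balanced_double_chain C1 C2 \<and> card (C1 \<union> C2) = n \<and> compatible_coloring G c (C1 \<union> C2) d"
  then show "embeddable G c (C1 \<union> C2) d"
    using embeddable_forest_of_stars[OF assms(1)] by simp
next
  assume "equitable_graph G \<and> (\<exists>C1 C2. balanced_double_chain C1 C2 \<and> card (C1 \<union> C2) = n \<and>
    two_color_universal (C1 \<union> C2) G)"
  then show "forest_of_caterpillars G"
    using universal_double_chain_forest_of_caterpillars assms(2) by (metis (no_types))
qed

end
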